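(* Let $k\in\mathbb{N}$ and assume $\mu(1/2)<\frac{1}{2k}$. Let $1/2<\sigma<1$ with $\sigma\neq\sigma_k$. Then the function $t\mapsto\zeta^k(\sigma+it)$ $(t\in\mathbb{R}^+)$ is not CNS (not concentrated on a null set) if and only if $\sigma_k<\sigma<1$.
   Context: $\zeta$ is the Riemann zeta function. $\mu(\sigma)=\inf\{\mu:\zeta(\sigma+it)\ll t^{\mu}\text{ as }t\to\infty\}$. $M_k(\sigma,T)=\int_0^T|\zeta(\sigma+it)|^{2k}\,dt$. For $k\in\mathbb{N}$, $\sigma_k$ is the infimum of the numbers $\sigma_0\in[1/2,1)$ such that $M_k(\sigma,T)\ll T$ (as $T\to\infty$) for every $\sigma_0<\sigma<1$. Thus $1/2\le\sigma_k<1$, $M_k(\sigma,T)\ll T$ for $\sigma_k<\sigma<1$, and $\limsup_{T\to\infty}M_k(\sigma,T)/T=\infty$ for $1/2\le\sigma<\sigma_k$. A Lebesgue measurable set $S\subseteq\mathbb{R}^+$ is null if its natural density is zero: $\lim_{T\to\infty}\mathrm{meas}(S\cap[0,T])/T=0$. A function $f\in L_{2,\mathrm{loc}}(\mathbb{R}^+)$ is said to be not concentrated on a null set (not CNS) if for every null set $S$, $$\int_{S\cap[0,T]}|f|^2dt=o\left(\int_0^T|f|^2dt\right)\qquad(T\to\infty).$$ Otherwise $f$ is CNS. *)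

theory Defs
  imports
    "HOL-Complex_Analysis.Complex_Analysis"
    "HOL-Library.Landau_Symbols"
    "HOL-Library.Extended_Real"
begin

(* The Riemann zeta function: the Dirichlet series of (n + 1) powr (-s), continued
   analytically to half-planes with the point 1 removed. Continuations to two such
   half-planes agree on the smaller one (lemma zeta_eqI), and every s other than 1 lies in
   one, so this is the usual meromorphic continuation to the plane. The value at the pole 1
   is unspecified. *)

definition zeta_continuation :: "real \<Rightarrow> (complex \<Rightarrow> complex) \<Rightarrow> bool" where
  "zeta_continuation c f \<longleftrightarrow>
     f holomorphic_on ({z. c < Re z} - {1}) \<and>
     (\<forall>z. 1 < Re z \<longrightarrow> (\<lambda>n. of_nat (Suc n) powr (- z)) sums f z)"

definition zeta :: "complex \<Rightarrow> complex" where
  "zeta s = (THE w. \<exists>c f. c < Re s \<and> zeta_continuation c f \<and> w = f s)"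

lemma zeta_eqI:
  assumes f: "zeta_continuation c f" and c: "c < Re s" and s: "s \<noteq> 1"
  shows "zeta s = f s"
proof -
  have "g s = f s" if d: "d < Re s" and g: "zeta_continuation d g" for d g
  proof -
    define m where "m = max c d"
    have op: "open {z. a < Re z}" and co: "connected {z. a < Re z}" for a :: real
      by (auto intro: open_halfspace_Re_gt convex_connected convex_halfspace_Re_gt)
    show ?thesis
    proof (rule analytic_continuation_open
        [of "{z. max m 1 < Re z}" "{z. m < Re z} - {1}" g f s])
      show "{z. max m 1 < Re z} \<noteq> {}"
        by (auto intro!: exI[of _ "of_real (max m 1 + 1)"])
      show "connected ({z. m < Re z} - {1})"
        using op co by (intro connected_open_delete) auto
      show "g holomorphic_on {z. m < Re z} - {1}" "f holomorphic_on {z. m < Re z} - {1}"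
        using f g unfolding zeta_continuation_def m_def
        by (auto elim!: holomorphic_on_subset)
      show "g z = f z" if "z \<in> {z. max m 1 < Re z}" for z
        using f g that unfolding zeta_continuation_def by (auto intro: sums_unique2)
      show "open {z. max m 1 < Re z}" "open ({z. m < Re z} - {1})"
        using op by (blast intro: open_delete)+
    qed (use c d s in \<open>auto simp: m_def\<close>)
  qed
  then show ?thesis
    unfolding zeta_def using f c by (intro the_equality) blast+
qed

(* Infima are taken in the extended reals, where they need no side conditions. *)

definition zeta_mu :: "real \<Rightarrow> ereal" where
  "zeta_mu \<sigma> =
     (INF m \<in> {m :: real. (\<lambda>t. norm (zeta (Complex \<sigma> t))) \<in> O[at_top](\<lambda>t. t powr m)}. ereal m)"

definition zeta_moment :: "nat \<Rightarrow> real \<Rightarrow> real \<Rightarrow> real" where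
  "zeta_moment k \<sigma> T = (LINT t:{0..T}|lebesgue. norm (zeta (Complex \<sigma> t)) ^ (2 * k))"

definition sigma_crit :: "nat \<Rightarrow> ereal" where
  "sigma_crit k =
     (INF \<sigma>0 \<in> {\<sigma>0 :: real. 1 / 2 \<le> \<sigma>0 \<and> \<sigma>0 < 1 \<and>
        (\<forall>\<sigma>. \<sigma>0 < \<sigma> \<and> \<sigma> < 1 \<longrightarrow> zeta_moment k \<sigma> \<in> O[at_top](\<lambda>T. T))}. ereal \<sigma>0)"

definition null_density :: "real set \<Rightarrow> bool" where
  "null_density S \<longleftrightarrow> S \<in> sets lebesgue \<and> S \<subseteq> {0..} \<and>
     ((\<lambda>T. measure lebesgue (S \<inter> {0..T}) / T) \<longlongrightarrow> 0) at_top"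

(* Functions on the half-line are represented by total functions on the reals; only their
   values on {0..} matter. *)

definition L2_loc :: "(real \<Rightarrow> complex) \<Rightarrow> bool" where
  "L2_loc f \<longleftrightarrow> set_borel_measurable lebesgue {0..} f \<and>
     (\<forall>T. set_integrable lebesgue {0..T} (\<lambda>t. (norm (f t))\<^sup>2))"

definition not_CNS :: "(real \<Rightarrow> complex) \<Rightarrow> bool" where
  "not_CNS f \<longleftrightarrow> L2_loc f \<and>
     (\<forall>S. null_density S \<longrightarrow>
        (\<lambda>T. LINT t:(S \<inter> {0..T})|lebesgue. (norm (f t))\<^sup>2)
          \<in> o[at_top](\<lambda>T. LINT t:{0..T}|lebesgue. (norm (f t))\<^sup>2))"

end

theory Submission
  imports Defs "HOL-Probability.Probability" "HOL-Real_Asymp.Real_Asymp"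
begin

text \<open>Everything rests on one inequality. Let \<open>f\<close> be holomorphic and of polynomial growth in a
strip \<open>a \<le> Re s \<le> b\<close> and bounded on the right edge, let \<open>a < c < b\<close>, and let \<open>S\<close> be a measurable subset of
\<open>{0..T}\<close>. The three lines theorem for
\<open>z \<mapsto> exp ((z - c)^2) * (integral over u in S of f (z + i u) * cnj (f (c + i u)))\<close>,
with the Cauchy-Schwarz inequality on both edges, bounds the integral of \<open>|f (c + i u)|^2\<close> over \<open>S\<close> by a
constant times \<open>J powr (1 - \<theta>) * |S| powr \<theta>\<close>, where \<open>J\<close> is essentially the mean square of \<open>f\<close> on the line
\<open>Re s = a\<close> up to height \<open>T\<close> and \<open>\<theta> = (c - a) / (b - a)\<close> (lemma \<open>shifted_mean_square_bound\<close>). It is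
applied to \<open>(\<zeta>(s) (s - 1) / (s + 1))^k\<close>, which has no pole, with \<open>b = 4\<close>.

Suppose \<open>\<sigma>\<^sub>k < \<sigma> < 1\<close> and take \<open>a\<close> between \<open>\<sigma>\<^sub>k\<close> and \<open>\<sigma>\<close>, so that \<open>J\<close> is of order \<open>T\<close>. The
inequality with \<open>c = \<sigma>\<close> shows that a set \<open>S\<close> of measure \<open>o(T)\<close> carries only \<open>o(T)\<close> of the integral of
\<open>|\<zeta>|^(2k)\<close>. The inequality with \<open>a = \<sigma>\<close>, \<open>c = 3\<close> and \<open>S = {0..T}\<close>, read backwards, shows that the full
integral is at least a constant times \<open>T\<close>, because \<open>\<zeta>\<close> is bounded away from \<open>0\<close> on \<open>Re s = 3\<close>
(lemma \<open>zeta_moment_lower\<close>). Hence \<open>\<zeta>^k\<close> is not CNS.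

Suppose \<open>1/2 < \<sigma> < \<sigma>\<^sub>k\<close>. With \<open>S = {0..T}\<close> the inequality says that boundedness of \<open>M_k(\<sigma>,T)/T\<close> is
inherited by larger \<open>\<sigma>\<close>, so \<open>M_k(\<sigma>,T)/T\<close> must be unbounded at \<open>\<sigma>\<close> itself. Choose heights \<open>X\<^sub>j\<close> with
\<open>M_k(\<sigma>,X\<^sub>j) > 2 j^(2k) X\<^sub>j\<close> and let \<open>S\<close> consist of the \<open>t\<close> with \<open>t \<le> X\<^sub>j\<close> and \<open>|\<zeta>(\<sigma> + i t)| \<ge> j\<close> for some
\<open>j\<close>. The complement of \<open>S\<close> carries less than half of \<open>M_k(\<sigma>,X\<^sub>j)\<close>, and \<open>S\<close> is null because large values of
\<open>\<zeta>\<close> are rare: the second moment of \<open>\<zeta>\<close> is \<open>O(T)\<close> for \<open>\<sigma> > 1/2\<close>.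

This second moment bound (lemma \<open>zeta_mean_square\<close>) comes from Fourier analysis. For \<open>0 < Re s < 1\<close>
the function \<open>-\<zeta>(s)/s\<close> is the two-sided Laplace transform of \<open>frac (exp y)\<close>. Multiplication by
\<open>exp (h s) - 1\<close> replaces this function by its difference with step \<open>h\<close>, and this difference is small in mean
square since \<open>frac\<close> jumps only at integers. For \<open>h\<close> of order \<open>1/T\<close> the factor \<open>exp (h s) - 1\<close> is of order
\<open>|s|/T\<close> on the segment, and Plancherel's inequality gives the bound.\<close>

section \<open>The three lines theorem and integrals with a holomorphic parameter\<close>

text \<open>Dividing by the holomorphic function of modulus \<open>A powr ((b - x) / (b - a)) * B powr ((x - a) / (b - a))\<close>
on \<open>Re z = x\<close> makes the bound \<open>1\<close> on both edges; the decay hypothesis supplies it on the horizontal sides of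
a tall rectangle, and the maximum modulus principle does the rest.\<close>

lemma three_lines:
  fixes F :: "complex \<Rightarrow> complex"
  assumes ab: "a < b" and A: "0 < A" and B: "0 < B"
    and cont: "continuous_on {z. a \<le> Re z \<and> Re z \<le> b} F"
    and hol: "F holomorphic_on {z. a < Re z \<and> Re z < b}"
    and decay: "\<And>e. 0 < e \<Longrightarrow> \<exists>R. \<forall>z. a \<le> Re z \<and> Re z \<le> b \<and> R \<le> \<bar>Im z\<bar> \<longrightarrow> norm (F z) \<le> e"
    and left: "\<And>z. Re z = a \<Longrightarrow> norm (F z) \<le> A"
    and right: "\<And>z. Re z = b \<Longrightarrow> norm (F z) \<le> B"
    and w: "a \<le> Re w" "Re w \<le> b"
  shows "norm (F w) \<le> A powr ((b - Re w) / (b - a)) * B powr ((Re w - a) / (b - a))"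
proof -
  define q where "q x = (ln A * (b - x) + ln B * (x - a)) / (b - a)" for x :: real
  define H where "H z = F z * exp (- (of_real (ln A) * (of_real b - z) + of_real (ln B) * (z - of_real a)) / of_real (b - a))" for z
  have normH: "norm (H z) = norm (F z) * exp (- q (Re z))" for z
  proof -
    have "Re (- (of_real (ln A) * (of_real b - z) + of_real (ln B) * (z - of_real a)) / of_real (b - a)) = - q (Re z)"
      unfolding q_def Re_divide_of_real by (simp add: minus_divide_left)
    then show ?thesis unfolding H_def norm_mult norm_exp_eq_Re by simp
  qed
  have q_ge: "- (\<bar>ln A\<bar> + \<bar>ln B\<bar>) \<le> q x" if "a \<le> x" "x \<le> b" for x
  proof -
    have "- \<bar>ln A\<bar> * (b - a) \<le> ln A * (b - x)"
      using that by (smt (verit) mult_minus_left mult_mono mult_right_mono abs_ge_self abs_ge_minus_self minus_mult_left)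
    moreover have "- \<bar>ln B\<bar> * (b - a) \<le> ln B * (x - a)"
      using that by (smt (verit) mult_minus_left mult_mono mult_right_mono abs_ge_self abs_ge_minus_self minus_mult_left)
    ultimately show ?thesis
      using ab unfolding q_def by (simp add: field_simps)
  qed
  define K where "K = exp (\<bar>ln A\<bar> + \<bar>ln B\<bar>)"
  obtain R where R: "\<And>z. a \<le> Re z \<Longrightarrow> Re z \<le> b \<Longrightarrow> R \<le> \<bar>Im z\<bar> \<Longrightarrow> norm (F z) \<le> 1 / K"
    using decay[of "1 / K"] unfolding K_def by auto
  define R' where "R' = max R (\<bar>Im w\<bar> + 1)"
  define S where "S = cbox (Complex a (- R')) (Complex b R')"
  have memS: "z \<in> S \<longleftrightarrow> a \<le> Re z \<and> Re z \<le> b \<and> \<bar>Im z\<bar> \<le> R'" for z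
    unfolding S_def in_cbox_complex_iff by auto
  have memI: "z \<in> interior S \<longleftrightarrow> a < Re z \<and> Re z < b \<and> \<bar>Im z\<bar> < R'" for z
    unfolding S_def interior_cbox in_box_complex_iff by auto
  have "norm (H w) \<le> 1"
  proof (rule maximum_modulus_frontier[of H S])
    show "H holomorphic_on interior S"
      unfolding H_def using ab memI
      by (intro holomorphic_intros holomorphic_on_subset[OF hol]) auto
    have "continuous_on S H"
      unfolding H_def using ab memS
      by (intro continuous_intros continuous_on_subset[OF cont]) auto
    then show "continuous_on (closure S) H"
      unfolding S_def by simp
    show "bounded S" unfolding S_def by simp
    show "w \<in> S" using memS w unfolding R'_def by auto
    fix z assume "z \<in> frontier S"
    then have z: "z \<in> S" "z \<notin> interior S"
      unfolding frontier_def S_def by auto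
    consider "Re z = a" | "Re z = b" | "a \<le> Re z" "Re z \<le> b" "\<bar>Im z\<bar> = R'"
      using z memS memI by force
    then show "norm (H z) \<le> 1"
    proof cases
      case 1
      then have "q (Re z) = ln A" using ab by (simp add: q_def)
      then show ?thesis
        using left[OF 1] A by (simp add: normH exp_minus field_simps)
    next
      case 2
      then have "q (Re z) = ln B" using ab by (simp add: q_def)
      then show ?thesis
        using right[OF 2] B by (simp add: normH exp_minus field_simps)
    next
      case 3
      have "norm (F z) \<le> 1 / K" using R 3 unfolding R'_def by auto
      moreover have "exp (- q (Re z)) \<le> K"
        unfolding K_def using q_ge[of "Re z"] 3 by simp
      ultimately have "norm (F z) * exp (- q (Re z)) \<le> (1 / K) * K"
        by (intro mult_mono) (auto simp: K_def)
      then show ?thesis by (simp add: normH K_def)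
    qed
  qed
  then have "norm (F w) \<le> exp (q (Re w))"
    by (simp add: normH exp_minus field_simps)
  also have "\<dots> = A powr ((b - Re w) / (b - a)) * B powr ((Re w - a) / (b - a))"
    using A B by (simp add: powr_def q_def add_divide_distrib mult.commute flip: exp_add)
  finally show ?thesis .
qed

text \<open>The integral of \<open>(t f - g)^2\<close> is a nonnegative quadratic polynomial in \<open>t\<close>; nonnegativity at the
vertex is the inequality.\<close>

lemma integral_Cauchy_Schwarz:
  fixes f g :: "'a \<Rightarrow> real"
  assumes f: "f \<in> borel_measurable M" "integrable M (\<lambda>x. (f x)\<^sup>2)"
    and g: "g \<in> borel_measurable M" "integrable M (\<lambda>x. (g x)\<^sup>2)"
  shows "integrable M (\<lambda>x. f x * g x)"
    and "(\<integral>x. f x * g x \<partial>M)\<^sup>2 \<le> (\<integral>x. (f x)\<^sup>2 \<partial>M) * (\<integral>x. (g x)\<^sup>2 \<partial>M)"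
proof -
  show fg: "integrable M (\<lambda>x. f x * g x)"
  proof (rule Bochner_Integration.integrable_bound[OF Bochner_Integration.integrable_add[OF f(2) g(2)]])
    show "(\<lambda>x. f x * g x) \<in> borel_measurable M" using f g by measurable
    have "\<bar>f x * g x\<bar> \<le> (f x)\<^sup>2 + (g x)\<^sup>2" for x
    proof -
      have "2 * (\<bar>f x\<bar> * \<bar>g x\<bar>) \<le> (f x)\<^sup>2 + (g x)\<^sup>2"
        using sum_squares_bound[of "\<bar>f x\<bar>" "\<bar>g x\<bar>"] by (simp add: mult.assoc)
      moreover have "0 \<le> \<bar>f x\<bar> * \<bar>g x\<bar>" by simp
      ultimately show ?thesis unfolding abs_mult by linarith
    qed
    then show "AE x in M. norm (f x * g x) \<le> norm ((f x)\<^sup>2 + (g x)\<^sup>2)"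
      by (intro AE_I2) (simp add: order_trans[OF _ abs_ge_self])
  qed
  define p q r where "p = (\<integral>x. (f x)\<^sup>2 \<partial>M)" and "q = (\<integral>x. (g x)\<^sup>2 \<partial>M)" and "r = (\<integral>x. f x * g x \<partial>M)"
  have quad: "0 \<le> t\<^sup>2 * p - 2 * t * r + q" for t
  proof -
    have "0 \<le> (\<integral>x. (t * f x - g x)\<^sup>2 \<partial>M)" by (rule integral_nonneg_AE) auto
    also have "(\<lambda>x. (t * f x - g x)\<^sup>2) = (\<lambda>x. t\<^sup>2 * (f x)\<^sup>2 - (2 * t) * (f x * g x) + (g x)\<^sup>2)"
      by (auto simp: power2_eq_square algebra_simps)
    also have "(\<integral>x. t\<^sup>2 * (f x)\<^sup>2 - (2 * t) * (f x * g x) + (g x)\<^sup>2 \<partial>M) = t\<^sup>2 * p - 2 * t * r + q"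
      unfolding p_def q_def r_def using f(2) g(2) fg by simp
    finally show ?thesis .
  qed
  have "p \<ge> 0" unfolding p_def by simp
  show "r\<^sup>2 \<le> p * q"
  proof (cases "p = 0")
    case True
    have "r = 0"
    proof (rule ccontr)
      assume "r \<noteq> 0"
      then show False using quad[of "(q + 1) / (2 * r)"] True by simp
    qed
    then show ?thesis using True by simp
  next
    case False
    then have "0 \<le> p * ((r / p)\<^sup>2 * p - 2 * (r / p) * r + q)"
      by (intro mult_nonneg_nonneg quad \<open>p \<ge> 0\<close>)
    also have "\<dots> = p * q - r\<^sup>2"
      using False by (simp add: field_simps power2_eq_square)
    finally show ?thesis by simp
  qed
qed

text \<open>On a small disc Cauchy's estimate bounds the difference quotients of \<open>F\<close> in the
parameter by a multiple of the majorant, so dominated convergence allows differentiation under the integral.\<close>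

lemma holomorphic_on_integral_parameter:
  fixes F :: "complex \<Rightarrow> 'a \<Rightarrow> complex"
  assumes U: "open U"
    and hol: "\<And>x. x \<in> space M \<Longrightarrow> (\<lambda>z. F z x) holomorphic_on U"
    and meas: "\<And>z. z \<in> U \<Longrightarrow> F z \<in> borel_measurable M"
    and dom: "\<And>z. z \<in> U \<Longrightarrow> \<exists>r g. 0 < r \<and> cball z r \<subseteq> U \<and> integrable M g \<and>
                (\<forall>w\<in>cball z r. \<forall>x\<in>space M. norm (F w x) \<le> g x)"
  shows "(\<lambda>z. \<integral>x. F z x \<partial>M) holomorphic_on U"
proof -
  have "\<exists>D. ((\<lambda>z. \<integral>x. F z x \<partial>M) has_field_derivative D) (at z)" if z: "z \<in> U" for z
  proof -
    obtain r g where r: "0 < r" "cball z r \<subseteq> U" and g: "integrable M g"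
      and le: "\<And>w x. w \<in> cball z r \<Longrightarrow> x \<in> space M \<Longrightarrow> norm (F w x) \<le> g x"
      using dom[OF z] by blast
    have int: "integrable M (F w)" if "w \<in> cball z r" for w
      using that le meas r
      by (intro Bochner_Integration.integrable_bound[OF g] AE_I2) (auto intro: order_trans[OF _ abs_ge_self])
    have der: "((\<lambda>w. F w x) has_field_derivative deriv (\<lambda>w. F w x) w) (at w)"
      if "x \<in> space M" "w \<in> U" for x w
      using hol[OF that(1)] U that(2) by (rule holomorphic_derivI)
    have lip: "norm (F w x - F z x) \<le> (2 * g x / r) * norm (w - z)"
      if x: "x \<in> space M" and w: "w \<in> ball z (r / 2)" for w x
    proof (rule field_differentiable_bound[of "ball z (r / 2)" "\<lambda>w. F w x" "deriv (\<lambda>w. F w x)"])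
      fix y assume y: "y \<in> ball z (r / 2)"
      have sub: "cball y (r / 2) \<subseteq> cball z r"
      proof
        fix t assume "t \<in> cball y (r / 2)"
        then show "t \<in> cball z r"
          using y dist_triangle[of z t y] by (auto simp: dist_commute)
      qed
      have "y \<in> U" using y r by auto
      then show "((\<lambda>w. F w x) has_field_derivative deriv (\<lambda>w. F w x) y) (at y within ball z (r / 2))"
        using der[OF x] has_field_derivative_at_within by blast
      have "norm ((deriv ^^ 1) (\<lambda>w. F w x) y) \<le> fact 1 * g x / (r / 2) ^ 1"
      proof (rule Cauchy_inequality)
        have h: "(\<lambda>w. F w x) holomorphic_on cball y (r / 2)"
          using sub r by (intro holomorphic_on_subset[OF hol[OF x]]) auto
        show "(\<lambda>w. F w x) holomorphic_on ball y (r / 2)"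
          by (rule holomorphic_on_subset[OF h]) auto
        show "continuous_on (cball y (r / 2)) (\<lambda>w. F w x)"
          by (rule holomorphic_on_imp_continuous_on[OF h])
        show "norm (F t x) \<le> g x" if "norm (y - t) = r / 2" for t
          using that sub le[OF _ x] by (auto simp: dist_norm subset_iff)
      qed (use r in auto)
      then show "norm (deriv (\<lambda>w. F w x) y) \<le> 2 * g x / r" by (simp add: field_simps)
    qed (use r w in auto)
    have "((\<lambda>w. ((\<integral>x. F w x \<partial>M) - (\<integral>x. F z x \<partial>M)) / (w - z)) \<longlongrightarrow>
            (\<integral>x. deriv (\<lambda>w. F w x) z \<partial>M)) (at z)"
      unfolding tendsto_at_iff_sequentially comp_def
    proof (intro allI impI)
      fix X :: "nat \<Rightarrow> complex"
      assume Xne: "\<forall>i. X i \<in> UNIV - {z}" and X: "X \<longlonglongrightarrow> z"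
      have "\<forall>\<^sub>F i in sequentially. X i \<in> ball z (r / 2)"
        using X r by (intro topological_tendstoD) auto
      then obtain N where N: "\<And>i. i \<ge> N \<Longrightarrow> X i \<in> ball z (r / 2)"
        by (auto simp: eventually_sequentially)
      define Y where "Y i = X (i + N)" for i
      have Y: "Y i \<in> ball z (r / 2)" "Y i \<in> cball z r" "Y i \<noteq> z" for i
        using N[of "i + N"] Xne r unfolding Y_def by auto
      have Yz: "Y \<longlonglongrightarrow> z" unfolding Y_def using X by (rule LIMSEQ_ignore_initial_segment)
      define s where "s i x = (F (Y i) x - F z x) / (Y i - z)" for i x
      have smeas: "s i \<in> borel_measurable M" for i
        unfolding s_def using int[OF Y(2)] int[of z] r by (intro borel_measurable_divide borel_measurable_diff) auto
      have lim: "(\<lambda>i. s i x) \<longlonglongrightarrow> deriv (\<lambda>w. F w x) z" if x: "x \<in> space M" for x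
      proof -
        have "((\<lambda>w. (F w x - F z x) / (w - z)) \<longlongrightarrow> deriv (\<lambda>w. F w x) z) (at z)"
          using der[OF x z] by (simp add: has_field_derivative_iff)
        then show ?thesis
          unfolding s_def tendsto_at_iff_sequentially comp_def using Y Yz by auto
      qed
      have "(\<lambda>i. \<integral>x. s i x \<partial>M) \<longlonglongrightarrow> (\<integral>x. deriv (\<lambda>w. F w x) z \<partial>M)"
      proof (rule integral_dominated_convergence[where w = "\<lambda>x. 2 * g x / r"])
        show "(\<lambda>x. deriv (\<lambda>w. F w x) z) \<in> borel_measurable M"
          using smeas lim by (rule borel_measurable_LIMSEQ_metric)
        show "integrable M (\<lambda>x. 2 * g x / r)" using g by simp
        show "AE x in M. norm (s i x) \<le> 2 * g x / r" for i
        proof (rule AE_I2)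
          fix x assume x: "x \<in> space M"
          show "norm (s i x) \<le> 2 * g x / r"
            using lip[OF x Y(1)[of i]] Y(3)[of i] unfolding s_def norm_divide
            by (simp add: divide_le_eq)
        qed
      qed (use smeas lim in auto)
      moreover have "(\<integral>x. s i x \<partial>M) = ((\<integral>x. F (X (i + N)) x \<partial>M) - (\<integral>x. F z x \<partial>M)) / (X (i + N) - z)" for i
        using int[OF Y(2)[of i]] int[of z] r unfolding s_def Y_def by simp
      ultimately have "(\<lambda>i. ((\<integral>x. F (X (i + N)) x \<partial>M) - (\<integral>x. F z x \<partial>M)) / (X (i + N) - z)) \<longlonglongrightarrow>
            (\<integral>x. deriv (\<lambda>w. F w x) z \<partial>M)"
        by simp
      then show "(\<lambda>i. ((\<integral>x. F (X i) x \<partial>M) - (\<integral>x. F z x \<partial>M)) / (X i - z)) \<longlonglongrightarrow>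
            (\<integral>x. deriv (\<lambda>w. F w x) z \<partial>M)"
        by (rule LIMSEQ_offset)
    qed
    then show ?thesis unfolding has_field_derivative_iff by blast
  qed
  then show ?thesis
    using U by (simp add: holomorphic_on_open)
qed

section \<open>Mean squares of a holomorphic function on parallel lines\<close>

lemma set_integrable_lebesgue_continuous:
  fixes g :: "real \<Rightarrow> 'b :: euclidean_space"
  assumes "continuous_on UNIV g" "S \<in> sets lebesgue" "S \<subseteq> {a..b}"
  shows "set_integrable lebesgue S g"
proof (rule set_integrable_subset)
  have "set_integrable lborel {a..b} g"
    by (intro borel_integrable_atLeastAtMost' continuous_on_subset[OF assms(1)]) auto
  then show "set_integrable lebesgue {a..b} g"
    unfolding set_integrable_def by (simp add: integrable_completion)
qed (use assms in auto)

text \<open>The pairing with \<open>cnj (f (c + i u))\<close> turns a mean square on the middle line into a value at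
\<open>z = c\<close> of a holomorphic function of the shift \<open>z\<close>. The Gaussian factor makes the three lines theorem applicable; it
also explains the weight in the hypothesis on \<open>J\<close>, which tames the growth in \<open>v\<close> of the mean square over the
shifted interval.\<close>

lemma shifted_mean_square_bound:
  fixes f :: "complex \<Rightarrow> complex"
  assumes ab: "a < c" "c < b" and a0: "a0 < a"
    and hol: "f holomorphic_on {z. a0 < Re z}"
    and growth: "\<And>z. a0 < Re z \<Longrightarrow> Re z \<le> b + 1 \<Longrightarrow> norm (f z) \<le> P * (1 + \<bar>Im z\<bar>) ^ N"
    and P: "0 \<le> P"
    and right: "\<And>z. Re z = b \<Longrightarrow> norm (f z) \<le> B" and B: "0 < B"
    and S: "S \<in> sets lebesgue" "S \<subseteq> {0..T}" and T: "0 \<le> T"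
    and J: "0 < J"
      "\<And>v. exp (- 2 * v\<^sup>2) * (LINT u:{0..T}|lebesgue. (norm (f (Complex a (u + v))))\<^sup>2) \<le> J"
    and m: "measure lebesgue S \<le> m" "0 < m"
  shows "(LINT u:S|lebesgue. (norm (f (Complex c u)))\<^sup>2)
           \<le> exp (2 * (b - a)\<^sup>2) * J powr ((b - c) / (b - a)) * (B\<^sup>2 * m) powr ((c - a) / (b - a))"
proof -
  define g where "g z u = f (z + \<i> * of_real u)" for z and u :: real
  define Q where "Q = (LINT u:S|lebesgue. (norm (f (Complex c u)))\<^sup>2)"
  have Cg: "f (Complex x (u + v)) = g (Complex x v) u" for x u v
    unfolding g_def by (rule arg_cong[of _ _ f]) (simp add: complex_eq_iff)
  have Cg0: "f (Complex x u) = g (of_real x) u" for x u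
    unfolding g_def by (rule arg_cong[of _ _ f]) (simp add: complex_eq_iff)
  have contg: "continuous_on UNIV (g z)" if "a0 < Re z" for z
    unfolding g_def using that
    by (intro continuous_on_compose2[OF holomorphic_on_imp_continuous_on[OF hol]] continuous_intros) auto
  have c0: "a0 < Re (of_real c)" using ab a0 by simp
  define W where "W z = (\<integral>u. indicator S u *\<^sub>R (g z u * cnj (g (of_real c) u)) \<partial>lebesgue)" for z
  define I where "I z = (LINT u:S|lebesgue. (norm (g z u))\<^sup>2)" for z
  have Ic: "I (of_real c) = Q" unfolding I_def Q_def Cg0 ..
  have intW: "set_integrable lebesgue S (\<lambda>u. g z u * cnj (g (of_real c) u))" if "a0 < Re z" for z
    using S contg[OF that] contg[OF c0]
    by (intro set_integrable_lebesgue_continuous[where a = 0 and b = T] continuous_intros) auto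
  have int2: "set_integrable lebesgue R (\<lambda>u. (norm (g z u))\<^sup>2)"
    if "a0 < Re z" "R \<in> sets lebesgue" "R \<subseteq> {0..T}" for z R
    using that contg[OF that(1)]
    by (intro set_integrable_lebesgue_continuous[where a = 0 and b = T] continuous_intros) auto
  have int1: "set_integrable lebesgue S (\<lambda>u. norm (g z u))" if "a0 < Re z" for z
    using S contg[OF that]
    by (intro set_integrable_lebesgue_continuous[where a = 0 and b = T] continuous_intros) auto
  have W_CS: "norm (W z) \<le> sqrt (I z) * sqrt Q" if z: "a0 < Re z" for z
  proof -
    define p where "p w u = indicator S u *\<^sub>R norm (g w u)" for w u
    have pm: "p w \<in> borel_measurable lebesgue" if "a0 < Re w" for w
      using int1[OF that] unfolding set_integrable_def p_def by (rule borel_measurable_integrable)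
    have p2: "(\<lambda>u. (p w u)\<^sup>2) = (\<lambda>u. indicator S u *\<^sub>R (norm (g w u))\<^sup>2)" for w
      unfolding p_def by (auto simp: indicator_def)
    have pi: "integrable lebesgue (\<lambda>u. (p w u)\<^sup>2)" if "a0 < Re w" for w
      using int2[OF that S] unfolding set_integrable_def p2 .
    have pI: "(\<integral>u. (p w u)\<^sup>2 \<partial>lebesgue) = I w" for w
      unfolding p2 I_def set_lebesgue_integral_def ..
    have "norm (W z) \<le> (\<integral>u. p z u * p (of_real c) u \<partial>lebesgue)"
      unfolding W_def
      by (rule order_trans[OF integral_norm_bound])
         (auto intro!: Bochner_Integration.integral_cong order_eq_refl simp: p_def norm_mult indicator_def)
    moreover have "(\<integral>u. p z u * p (of_real c) u \<partial>lebesgue)\<^sup>2 \<le> I z * Q"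
      using integral_Cauchy_Schwarz(2)[OF pm[OF z] pi[OF z] pm[OF c0] pi[OF c0]] by (simp add: pI Ic)
    ultimately show ?thesis
      by (smt (verit) real_le_rsqrt real_sqrt_mult)
  qed
  have W_growth: "norm (W z) \<le> P * (1 + \<bar>Im z\<bar> + T) ^ N * (LINT u:S|lebesgue. norm (g (of_real c) u))"
    if z: "a0 < Re z" "Re z \<le> b + 1" for z
  proof -
    have "norm (W z) \<le> (\<integral>u. indicator S u *\<^sub>R (P * (1 + \<bar>Im z\<bar> + T) ^ N * norm (g (of_real c) u)) \<partial>lebesgue)"
      unfolding W_def
    proof (rule Bochner_Integration.integral_norm_bound_integral)
      show "integrable lebesgue (\<lambda>u. indicat_real S u *\<^sub>R (P * (1 + \<bar>Im z\<bar> + T) ^ N * norm (g (of_real c) u)))"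
        using set_integrable_mult_right[OF int1[OF c0]] unfolding set_integrable_def by blast
      show "integrable lebesgue (\<lambda>u. indicat_real S u *\<^sub>R (g z u * cnj (g (of_real c) u)))"
        using intW[OF z(1)] unfolding set_integrable_def .
      fix u
      have "norm (g z u) \<le> P * (1 + \<bar>Im z\<bar> + T) ^ N" if "u \<in> S"
      proof -
        have u: "0 \<le> u" "u \<le> T" using that S by auto
        have "norm (g z u) \<le> P * (1 + \<bar>Im z + u\<bar>) ^ N"
          using growth[of "z + \<i> * of_real u"] z unfolding g_def by simp
        also have "\<dots> \<le> P * (1 + \<bar>Im z\<bar> + T) ^ N"
          using u P by (intro mult_left_mono power_mono) auto
        finally show ?thesis .
      qed
      then show "norm (indicat_real S u *\<^sub>R (g z u * cnj (g (of_real c) u)))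
          \<le> indicat_real S u *\<^sub>R (P * (1 + \<bar>Im z\<bar> + T) ^ N * norm (g (of_real c) u))"
        by (auto simp: indicator_def norm_mult intro: mult_right_mono)
    qed
    also have "\<dots> = (LINT u:S|lebesgue. P * (1 + \<bar>Im z\<bar> + T) ^ N * norm (g (of_real c) u))"
      unfolding set_lebesgue_integral_def ..
    also have "\<dots> = P * (1 + \<bar>Im z\<bar> + T) ^ N * (LINT u:S|lebesgue. norm (g (of_real c) u))"
      by (rule set_integral_mult_right)
    finally show ?thesis .
  qed
  have W_hol: "W holomorphic_on {z. a0 < Re z \<and> Re z < b + 1}"
    unfolding W_def
  proof (rule holomorphic_on_integral_parameter)
    show "open {z. a0 < Re z \<and> Re z < b + 1}"
      by (intro open_Collect_conj open_halfspace_Re_gt open_halfspace_Re_lt)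
    show "(\<lambda>z. indicat_real S u *\<^sub>R (g z u * cnj (g (of_real c) u))) holomorphic_on {z. a0 < Re z \<and> Re z < b + 1}" for u
      unfolding g_def scaleR_conv_of_real
      by (intro holomorphic_intros holomorphic_on_compose_gen[OF _ hol, unfolded o_def]) auto
    show "(\<lambda>u. indicat_real S u *\<^sub>R (g z u * cnj (g (of_real c) u))) \<in> borel_measurable lebesgue"
      if "z \<in> {z. a0 < Re z \<and> Re z < b + 1}" for z
      using intW[of z] that unfolding set_integrable_def by (auto intro: borel_measurable_integrable)
    fix z assume z: "z \<in> {z. a0 < Re z \<and> Re z < b + 1}"
    then obtain r where r: "0 < r" "cball z r \<subseteq> {z. a0 < Re z \<and> Re z < b + 1}"
      using \<open>open {z. a0 < Re z \<and> Re z < b + 1}\<close> open_contains_cball by blast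
    define K where "K = P * (1 + \<bar>Im z\<bar> + r + T) ^ N"
    have "norm (indicat_real S u *\<^sub>R (g w u * cnj (g (of_real c) u))) \<le> indicat_real S u *\<^sub>R (K * norm (g (of_real c) u))"
      if w: "w \<in> cball z r" for w u
    proof -
      have "norm (g w u) \<le> K" if "u \<in> S"
      proof -
        have u: "0 \<le> u" "u \<le> T" using that S by auto
        have "\<bar>Im w - Im z\<bar> \<le> r"
          using w abs_Im_le_cmod[of "w - z"] by (simp add: dist_norm norm_minus_commute)
        then have le: "\<bar>Im w + u\<bar> \<le> \<bar>Im z\<bar> + r + T" using u by auto
        have "norm (g w u) \<le> P * (1 + \<bar>Im w + u\<bar>) ^ N"
          using growth[of "w + \<i> * of_real u"] w r unfolding g_def by auto
        also have "\<dots> \<le> K"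
          unfolding K_def using le P by (intro mult_left_mono power_mono) auto
        finally show ?thesis .
      qed
      then show ?thesis
        by (auto simp: indicator_def norm_mult intro: mult_right_mono)
    qed
    moreover have "integrable lebesgue (\<lambda>u. indicat_real S u *\<^sub>R (K * norm (g (of_real c) u)))"
      using set_integrable_mult_right[OF int1[OF c0]] unfolding set_integrable_def by blast
    ultimately show "\<exists>r h. 0 < r \<and> cball z r \<subseteq> {z. a0 < Re z \<and> Re z < b + 1} \<and> integrable lebesgue h \<and>
        (\<forall>w\<in>cball z r. \<forall>x\<in>space lebesgue. norm (indicat_real S x *\<^sub>R (g w x * cnj (g (of_real c) x))) \<le> h x)"
      using r by blast
  qed
  \<comment> \<open>Centring the Gaussian at \<open>c\<close> keeps the value at \<open>c\<close> unchanged.\<close>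
  define F where "F z = exp ((z - of_real c)\<^sup>2) * W z" for z
  have normF: "norm (F z) = exp ((Re z - c)\<^sup>2 - (Im z)\<^sup>2) * norm (W z)" for z
    unfolding F_def norm_mult norm_exp_eq_Re by (simp add: power2_eq_square)
  have expF: "exp ((Re z - c)\<^sup>2 - (Im z)\<^sup>2) \<le> exp ((b - a)\<^sup>2) * exp (- (Im z)\<^sup>2)" if "a \<le> Re z" "Re z \<le> b" for z
  proof -
    have "(Re z - c)\<^sup>2 \<le> (b - a)\<^sup>2"
      using that ab by (intro abs_le_square_iff[THEN iffD1]) auto
    then show ?thesis by (simp flip: exp_add)
  qed
  have Fc: "norm (F (of_real c)) = Q"
  proof -
    have "W (of_real c) = of_real (I (of_real c))"
      unfolding W_def I_def set_lebesgue_integral_def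
      by (simp flip: integral_complex_of_real add: complex_norm_square scaleR_conv_of_real del: of_real_power)
    moreover have "0 \<le> Q" unfolding Q_def set_lebesgue_integral_def by (intro integral_nonneg_AE) auto
    ultimately show ?thesis by (simp add: normF Ic)
  qed
  show ?thesis
  proof (cases "Q = 0")
    case True
    then show ?thesis unfolding Q_def by simp
  next
    case False
    moreover have "0 \<le> Q" unfolding Q_def set_lebesgue_integral_def by (intro integral_nonneg_AE) auto
    ultimately have Q: "0 < Q" by simp
    define E where "E = exp ((b - a)\<^sup>2)"
    have E: "0 < E" unfolding E_def by simp
    define th where "th = (c - a) / (b - a)"
    have th: "(b - c) / (b - a) = 1 - th" using ab unfolding th_def by (simp add: field_simps)
    have "norm (F (of_real c)) \<le> (E * sqrt J * sqrt Q) powr ((b - Re (of_real c)) / (b - a))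
            * (E * (B * sqrt m) * sqrt Q) powr ((Re (of_real c) - a) / (b - a))"
    proof (rule three_lines)
      show "a < b" "0 < E * sqrt J * sqrt Q" "0 < E * (B * sqrt m) * sqrt Q" using ab E B J m Q by auto
      have hF: "F holomorphic_on {z. a0 < Re z \<and> Re z < b + 1}"
        unfolding F_def by (intro holomorphic_intros W_hol)
      show "continuous_on {z. a \<le> Re z \<and> Re z \<le> b} F"
        using a0 by (intro holomorphic_on_imp_continuous_on holomorphic_on_subset[OF hF]) auto
      show "F holomorphic_on {z. a < Re z \<and> Re z < b}"
        using a0 by (intro holomorphic_on_subset[OF hF]) auto
      show "norm (F z) \<le> E * sqrt J * sqrt Q" if z: "Re z = a" for z
      proof -
        have z0: "a0 < Re z" "z = Complex a (Im z)" using z a0 by (auto simp: complex_eq_iff)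
        have "I z \<le> (LINT u:{0..T}|lebesgue. (norm (g z u))\<^sup>2)"
          unfolding I_def set_lebesgue_integral_def
          by (intro integral_mono int2[OF z0(1), unfolded set_integrable_def]) (use S in \<open>auto simp: indicator_def\<close>)
        also have "\<dots> \<le> J * exp (2 * (Im z)\<^sup>2)"
          using J(2)[of "Im z"] z0(2) unfolding Cg by (simp add: exp_minus field_simps)
        finally have "sqrt (I z) \<le> sqrt (J * exp (2 * (Im z)\<^sup>2))" by simp
        also have "exp (2 * (Im z)\<^sup>2) = (exp ((Im z)\<^sup>2))\<^sup>2" by (simp flip: exp_double)
        also have "sqrt (J * (exp ((Im z)\<^sup>2))\<^sup>2) = sqrt J * exp ((Im z)\<^sup>2)" by (simp add: real_sqrt_mult)
        finally have 1: "norm (W z) \<le> sqrt J * exp ((Im z)\<^sup>2) * sqrt Q"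
          using W_CS[OF z0(1)] Q by (smt (verit) mult_right_mono real_sqrt_ge_zero)
        have "norm (F z) \<le> (E * exp (- (Im z)\<^sup>2)) * (sqrt J * exp ((Im z)\<^sup>2) * sqrt Q)"
          unfolding normF E_def using expF[of z] z ab 1 by (intro mult_mono) auto
        then show ?thesis by (simp add: exp_minus field_simps)
      qed
      show "norm (F z) \<le> E * (B * sqrt m) * sqrt Q" if z: "Re z = b" for z
      proof -
        have z0: "a0 < Re z" using z a0 ab by auto
        have fin: "emeasure lebesgue S < \<infinity>"
          by (rule le_less_trans[OF emeasure_mono[OF S(2)]]) (use T in auto)
        have "I z \<le> (\<integral>u. indicat_real S u *\<^sub>R B\<^sup>2 \<partial>lebesgue)"
          unfolding I_def set_lebesgue_integral_def
        proof (intro integral_mono int2[OF z0, unfolded set_integrable_def] S)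
          show "integrable lebesgue (\<lambda>u. indicat_real S u *\<^sub>R B\<^sup>2)" using fin S by simp
          show "indicat_real S u *\<^sub>R (norm (g z u))\<^sup>2 \<le> indicat_real S u *\<^sub>R B\<^sup>2" for u
            unfolding g_def using right[of "z + \<i> * of_real u"] z B by (auto simp: indicator_def)
        qed
        also have "\<dots> = measure lebesgue S * B\<^sup>2" using S fin by simp
        also have "\<dots> \<le> m * B\<^sup>2" using m by (intro mult_right_mono) auto
        finally have "sqrt (I z) \<le> sqrt (m * B\<^sup>2)" by simp
        also have "\<dots> = B * sqrt m" using B by (simp add: real_sqrt_mult)
        finally have 1: "norm (W z) \<le> (B * sqrt m) * sqrt Q"
          using W_CS[OF z0(1)] Q by (smt (verit) mult_right_mono real_sqrt_ge_zero)
        have "exp ((Re z - c)\<^sup>2 - (Im z)\<^sup>2) \<le> E * exp (- (Im z)\<^sup>2)"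
          unfolding E_def using expF[of z] z ab by simp
        also have "\<dots> \<le> E * 1" using E by (intro mult_left_mono) auto
        finally have "norm (F z) \<le> (E * 1) * ((B * sqrt m) * sqrt Q)"
          unfolding normF using 1 E by (intro mult_mono) auto
        then show ?thesis by simp
      qed
      show "\<exists>R. \<forall>z. a \<le> Re z \<and> Re z \<le> b \<and> R \<le> \<bar>Im z\<bar> \<longrightarrow> norm (F z) \<le> e" if e: "0 < e" for e
      proof -
        define L where "L = (LINT u:S|lebesgue. norm (g (of_real c) u))"
        have L: "0 \<le> L" unfolding L_def set_lebesgue_integral_def by (intro integral_nonneg_AE) auto
        define K where "K = E * P * L"
        have "((\<lambda>v. (1 + v + T) ^ N / exp (1 + v + T)) \<longlongrightarrow> 0) at_top"
        proof (rule filterlim_compose[OF tendsto_power_div_exp_0])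
          have "filterlim (\<lambda>v. (1 + T) + v) at_top at_top"
            by (rule filterlim_tendsto_add_at_top[OF tendsto_const filterlim_ident])
          then show "filterlim (\<lambda>v. 1 + v + T) at_top at_top" by (simp add: add_ac)
        qed
        then have "((\<lambda>v. K * ((1 + v + T) ^ N / exp (1 + v + T))) \<longlongrightarrow> 0) at_top"
          by (rule tendsto_mult_right_zero)
        then have "\<forall>\<^sub>F v in at_top. K * ((1 + v + T) ^ N / exp (1 + v + T)) < e"
          using e by (intro order_tendstoD) auto
        then obtain R where R: "\<And>v. R \<le> v \<Longrightarrow> K * ((1 + v + T) ^ N / exp (1 + v + T)) < e"
          by (auto simp: eventually_at_top_linorder)
        have "norm (F z) \<le> e" if z: "a \<le> Re z" "Re z \<le> b" "max R (2 + T) \<le> \<bar>Im z\<bar>" for z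
        proof -
          define v where "v = \<bar>Im z\<bar>"
          have v: "R \<le> v" "2 + T \<le> v" "0 \<le> v" using z(3) T unfolding v_def by auto
          have "norm (W z) \<le> P * (1 + v + T) ^ N * L"
            using W_growth[of z] z a0 unfolding v_def L_def by auto
          then have "norm (F z) \<le> (E * exp (- v\<^sup>2)) * (P * (1 + v + T) ^ N * L)"
            unfolding normF E_def v_def using expF[of z] z ab by (intro mult_mono) auto
          also have "\<dots> \<le> (E * exp (- (1 + v + T))) * (P * (1 + v + T) ^ N * L)"
          proof -
            have "(2 + T) * v \<le> v * v" using v by (intro mult_right_mono) auto
            moreover have "1 * 2 \<le> (1 + T) * v" using v T by (intro mult_mono) auto
            moreover have "T * 1 \<le> T * v" using v T by (intro mult_left_mono) auto
            ultimately have "1 + v + T \<le> v\<^sup>2"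
              using v T by (simp add: power2_eq_square algebra_simps)
            then show ?thesis
              using E P L v T by (intro mult_right_mono mult_left_mono) auto
          qed
          also have "\<dots> = K * ((1 + v + T) ^ N / exp (1 + v + T))"
            unfolding K_def by (simp only: exp_minus) (simp add: field_simps)
          also have "\<dots> \<le> e" using R[OF v(1)] by simp
          finally show ?thesis .
        qed
        then show ?thesis by blast
      qed
    qed (use ab in auto)
    then have "Q \<le> (E * sqrt J * sqrt Q) powr (1 - th) * (E * (B * sqrt m) * sqrt Q) powr th"
      unfolding Fc Re_complex_of_real th by (simp add: th_def)
    then have "Q\<^sup>2 \<le> ((E * sqrt J * sqrt Q) powr (1 - th) * (E * (B * sqrt m) * sqrt Q) powr th)\<^sup>2"
      using Q by (intro power_mono) auto
    also have "\<dots> = ((E * sqrt J * sqrt Q)\<^sup>2) powr (1 - th) * ((E * (B * sqrt m) * sqrt Q)\<^sup>2) powr th"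
      using E B J m Q by (simp add: power2_eq_square powr_mult)
    also have "(E * sqrt J * sqrt Q)\<^sup>2 = (E\<^sup>2 * Q) * J"
      using J Q by (simp add: power_mult_distrib)
    also have "(E * (B * sqrt m) * sqrt Q)\<^sup>2 = (E\<^sup>2 * Q) * (B\<^sup>2 * m)"
      using m Q by (simp add: power_mult_distrib)
    also have "((E\<^sup>2 * Q) * J) powr (1 - th) * ((E\<^sup>2 * Q) * (B\<^sup>2 * m)) powr th
        = ((E\<^sup>2 * Q) powr (1 - th) * (E\<^sup>2 * Q) powr th) * (J powr (1 - th) * (B\<^sup>2 * m) powr th)"
      using E B J m Q by (simp add: powr_mult)
    also have "(E\<^sup>2 * Q) powr (1 - th) * (E\<^sup>2 * Q) powr th = E\<^sup>2 * Q"
      using E Q by (simp flip: powr_add)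
    finally have "Q * Q \<le> Q * (E\<^sup>2 * J powr (1 - th) * (B\<^sup>2 * m) powr th)"
      by (simp add: power2_eq_square algebra_simps)
    then have "Q \<le> E\<^sup>2 * J powr (1 - th) * (B\<^sup>2 * m) powr th" using Q by simp
    moreover have "E\<^sup>2 = exp (2 * (b - a)\<^sup>2)" unfolding E_def by (simp flip: exp_double)
    ultimately show ?thesis unfolding Q_def[symmetric] th th_def[symmetric] by simp
  qed
qed

section \<open>An inequality of Plancherel type\<close>

definition fourier :: "(real \<Rightarrow> real) \<Rightarrow> real \<Rightarrow> complex" where
  "fourier \<psi> t = (\<integral>y. of_real (\<psi> y) * iexp (- (t * y)) \<partial>lborel)"

lemma gaussian_integral:
  fixes A :: real
  assumes "0 < A"
  shows "has_bochner_integral lborel (\<lambda>u. exp (- (A * (u - y))\<^sup>2 / 2)) (sqrt (2 * pi) / A)"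
proof -
  have eq: "normal_density y (1 / A) u * (sqrt (2 * pi) / A) = exp (- (A * (u - y))\<^sup>2 / 2)" for u
    using assms unfolding normal_density_def
    by (simp add: real_sqrt_mult real_sqrt_divide power_mult_distrib power_divide mult.commute)
  have "has_bochner_integral lborel (\<lambda>u. normal_density y (1 / A) u * (sqrt (2 * pi) / A)) (1 * (sqrt (2 * pi) / A))"
    using assms
    by (intro has_bochner_integral_mult_left) (auto simp: has_bochner_integral_iff)
  then show ?thesis unfolding eq mult_1_left .
qed

text \<open>A smooth cutoff avoids Plancherel's theorem. The mean of \<open>|fourier \<psi> (A t)|^2\<close> with
respect to the normal distribution is, by Fubini, a double integral of \<open>\<psi> y * \<psi> y'\<close> against the Gaussian kernel
\<open>exp (- (A * (y' - y))\<^sup>2 / 2)\<close>, and \<open>2 * \<psi> y * \<psi> y' \<le> (\<psi> y)\<^sup>2 + (\<psi> y')\<^sup>2\<close> reduces it to the total mass of the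
kernel.\<close>

lemma fourier_mean_square:
  fixes \<psi> :: "real \<Rightarrow> real"
  assumes \<psi>: "integrable lborel \<psi>" and \<psi>2: "integrable lborel (\<lambda>y. (\<psi> y)\<^sup>2)" and A: "0 < A"
  shows "(LINT t:{- A..A}|lborel. (norm (fourier \<psi> t))\<^sup>2) \<le> 2 * pi * exp (1 / 2) * (\<integral>y. (\<psi> y)\<^sup>2 \<partial>lborel)"
proof -
  have [measurable]: "\<psi> \<in> borel_measurable lborel" using \<psi> by simp
  have N: "prob_space std_normal_distribution" 
    using real_dist_normal_dist by (simp add: real_distribution_def)
  interpret N: prob_space std_normal_distribution by (rule N)
  interpret NP: pair_sigma_finite std_normal_distribution "lborel \<Otimes>\<^sub>M lborel :: (real \<times> real) measure"
    by unfold_locales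
  define X where "X p = \<psi> (fst p) * \<psi> (snd p)" for p
  define \<kappa> where "\<kappa> p = exp (- (A * (snd p - fst p))\<^sup>2 / 2)" for p :: "real \<times> real"
  define c where "c = sqrt (2 * pi) / A"
  have c: "0 < c" using A unfolding c_def by simp
  have meas [measurable]: "X \<in> borel_measurable (lborel \<Otimes>\<^sub>M lborel)" "\<kappa> \<in> borel_measurable (lborel \<Otimes>\<^sub>M lborel)"
    unfolding X_def \<kappa>_def by measurable
  have Xint: "integrable (lborel \<Otimes>\<^sub>M lborel) X"
    unfolding X_def using \<psi>
    by (intro lborel_pair.Fubini_integrable) (auto simp: abs_mult)
  have four: "integrable lborel (\<lambda>y. of_real (\<psi> y) * iexp (- (t * y)))" for t
    by (rule Bochner_Integration.integrable_bound[OF \<psi>]) (auto simp: norm_mult)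
  have four': "integrable lborel (\<lambda>y. of_real (\<psi> y) * iexp (t * y))" for t
    by (rule Bochner_Integration.integrable_bound[OF \<psi>]) (auto simp: norm_mult)
  define f where "f t p = of_real (X p) * iexp (A * t * (snd p - fst p))" for t p
  have f_split: "f t (y, y') = (of_real (\<psi> y) * iexp (- (A * t * y))) * (of_real (\<psi> y') * iexp (A * t * y'))" for t y y'
    unfolding f_def X_def by (simp add: algebra_simps flip: exp_add)
  have f_int: "integrable (lborel \<Otimes>\<^sub>M lborel) (f t)" for t
    unfolding f_def by (rule Bochner_Integration.integrable_bound[OF Xint]) (auto simp: norm_mult)
  have inner1: "(\<integral>p. f t p \<partial>(lborel \<Otimes>\<^sub>M lborel)) = of_real ((norm (fourier \<psi> (A * t)))\<^sup>2)" for t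
  proof -
    have "(\<integral>p. f t p \<partial>(lborel \<Otimes>\<^sub>M lborel)) = (\<integral>y. \<integral>y'. f t (y, y') \<partial>lborel \<partial>lborel)"
      by (rule lborel_pair.integral_fst'[symmetric, OF f_int])
    also have "\<dots> = fourier \<psi> (A * t) * (\<integral>y'. of_real (\<psi> y') * iexp (A * t * y') \<partial>lborel)"
      unfolding f_split fourier_def by simp
    also have "(\<integral>y'. of_real (\<psi> y') * iexp (A * t * y') \<partial>lborel) = cnj (fourier \<psi> (A * t))"
      unfolding fourier_def Bochner_Integration.integral_cnj[symmetric]
      by (intro Bochner_Integration.integral_cong) (auto simp: exp_cnj)
    finally show ?thesis by (simp add: complex_norm_square del: of_real_power)
  qed
  have inner2: "(\<integral>t. f t p \<partial>std_normal_distribution) = of_real (X p * \<kappa> p)" for p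
  proof -
    have "(\<integral>t. f t p \<partial>std_normal_distribution)
        = of_real (X p) * (\<integral>t. iexp (A * (snd p - fst p) * t) \<partial>std_normal_distribution)"
      unfolding f_def by (simp add: mult_ac)
    also have "(\<integral>t. iexp (A * (snd p - fst p) * t) \<partial>std_normal_distribution)
        = char std_normal_distribution (A * (snd p - fst p))"
      unfolding char_def ..
    finally show ?thesis by (simp add: char_std_normal_distribution \<kappa>_def)
  qed
  have f_int': "integrable (std_normal_distribution \<Otimes>\<^sub>M (lborel \<Otimes>\<^sub>M lborel)) (\<lambda>(t, p). f t p)"
  proof (rule NP.Fubini_integrable)
    show "(\<lambda>(t, p). f t p) \<in> borel_measurable (std_normal_distribution \<Otimes>\<^sub>M (lborel \<Otimes>\<^sub>M lborel))"
      unfolding f_def by measurable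
    have "(\<integral>p. norm (f t p) \<partial>(lborel \<Otimes>\<^sub>M lborel)) = (\<integral>p. norm (X p) \<partial>(lborel \<Otimes>\<^sub>M lborel))" for t
      unfolding f_def by (simp add: norm_mult)
    then show "integrable std_normal_distribution (\<lambda>t. \<integral>p. norm (case (t, p) of (t, p) \<Rightarrow> f t p) \<partial>(lborel \<Otimes>\<^sub>M lborel))"
      by simp
    show "AE t in std_normal_distribution. integrable (lborel \<Otimes>\<^sub>M lborel) (\<lambda>p. case (t, p) of (t, p) \<Rightarrow> f t p)"
      using f_int by simp
  qed
  have fub: "(\<integral>t. of_real ((norm (fourier \<psi> (A * t)))\<^sup>2) \<partial>std_normal_distribution)
      = (complex_of_real (\<integral>p. X p * \<kappa> p \<partial>(lborel \<Otimes>\<^sub>M lborel)))"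
    using NP.Fubini_integral[OF f_int'] unfolding inner1 inner2 integral_complex_of_real by simp
  have wint: "integrable std_normal_distribution (\<lambda>t. (norm (fourier \<psi> (A * t)))\<^sup>2)"
  proof -
    have "integrable std_normal_distribution (\<lambda>t. \<integral>p. f t p \<partial>(lborel \<Otimes>\<^sub>M lborel))"
      using NP.integrable_fst[OF f_int'] .
    then show ?thesis unfolding inner1 by (simp only: complex_of_real_integrable_eq)
  qed
  have fub': "(\<integral>t. (norm (fourier \<psi> (A * t)))\<^sup>2 \<partial>std_normal_distribution) = (\<integral>p. X p * \<kappa> p \<partial>(lborel \<Otimes>\<^sub>M lborel))"
    using fub unfolding integral_complex_of_real of_real_eq_iff .
  have sq_int: "integrable (lborel \<Otimes>\<^sub>M lborel) (\<lambda>p. (\<psi> (fst p))\<^sup>2 * \<kappa> p)"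
    and sq_eq: "(\<integral>p. (\<psi> (fst p))\<^sup>2 * \<kappa> p \<partial>(lborel \<Otimes>\<^sub>M lborel)) = (\<integral>y. (\<psi> y)\<^sup>2 \<partial>lborel) * c"
  proof -
    have \<kappa>i: "integrable lborel (\<lambda>y'. \<kappa> (y, y'))" "(\<integral>y'. \<kappa> (y, y') \<partial>lborel) = c" for y
      using gaussian_integral[OF A, of y] unfolding has_bochner_integral_iff \<kappa>_def c_def by auto
    have \<kappa>p: "0 \<le> \<kappa> p" for p unfolding \<kappa>_def by simp
    show si: "integrable (lborel \<Otimes>\<^sub>M lborel) (\<lambda>p. (\<psi> (fst p))\<^sup>2 * \<kappa> p)"
    proof (rule lborel_pair.Fubini_integrable)
      show "AE y in lborel. integrable lborel (\<lambda>y'. (\<psi> (fst (y, y')))\<^sup>2 * \<kappa> (y, y'))"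
        using \<kappa>i by auto
      show "integrable lborel (\<lambda>y. \<integral>y'. norm ((\<psi> (fst (y, y')))\<^sup>2 * \<kappa> (y, y')) \<partial>lborel)"
        using \<psi>2 by (simp add: abs_mult \<kappa>p \<kappa>i)
    qed measurable
    show "(\<integral>p. (\<psi> (fst p))\<^sup>2 * \<kappa> p \<partial>(lborel \<Otimes>\<^sub>M lborel)) = (\<integral>y. (\<psi> y)\<^sup>2 \<partial>lborel) * c"
      using lborel_pair.integral_fst'[OF si] by (simp add: \<kappa>i)
  qed
  have swap: "(\<lambda>(x, y). (\<psi> (fst (y, x)))\<^sup>2 * \<kappa> (y, x)) = (\<lambda>p. (\<psi> (snd p))\<^sup>2 * \<kappa> p)"
    unfolding \<kappa>_def by (auto simp: fun_eq_iff power2_commute power_mult_distrib)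
  have sq_int': "integrable (lborel \<Otimes>\<^sub>M lborel) (\<lambda>p. (\<psi> (snd p))\<^sup>2 * \<kappa> p)"
    using lborel_pair.integrable_product_swap[OF sq_int] unfolding swap .
  have sq_eq': "(\<integral>p. (\<psi> (snd p))\<^sup>2 * \<kappa> p \<partial>(lborel \<Otimes>\<^sub>M lborel)) = (\<integral>y. (\<psi> y)\<^sup>2 \<partial>lborel) * c"
    using lborel_pair.integral_product_swap[OF borel_measurable_integrable[OF sq_int]] unfolding swap sq_eq .
  have "(\<integral>p. X p * \<kappa> p \<partial>(lborel \<Otimes>\<^sub>M lborel))
      \<le> (\<integral>p. ((\<psi> (fst p))\<^sup>2 * \<kappa> p + (\<psi> (snd p))\<^sup>2 * \<kappa> p) / 2 \<partial>(lborel \<Otimes>\<^sub>M lborel))"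
  proof (rule integral_mono)
    show "integrable (lborel \<Otimes>\<^sub>M lborel) (\<lambda>p. X p * \<kappa> p)"
      by (rule Bochner_Integration.integrable_bound[OF Xint]) (auto simp: \<kappa>_def abs_mult intro!: mult_left_le)
    show "X p * \<kappa> p \<le> ((\<psi> (fst p))\<^sup>2 * \<kappa> p + (\<psi> (snd p))\<^sup>2 * \<kappa> p) / 2" for p
    proof -
      have "X p \<le> ((\<psi> (fst p))\<^sup>2 + (\<psi> (snd p))\<^sup>2) / 2"
        using sum_squares_bound[of "\<psi> (fst p)" "\<psi> (snd p)"] unfolding X_def by simp
      then have "X p * \<kappa> p \<le> ((\<psi> (fst p))\<^sup>2 + (\<psi> (snd p))\<^sup>2) / 2 * \<kappa> p"
        by (rule mult_right_mono) (simp add: \<kappa>_def)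
      then show ?thesis by (simp add: algebra_simps)
    qed
  qed (use sq_int sq_int' in auto)
  also have "\<dots> = (\<integral>y. (\<psi> y)\<^sup>2 \<partial>lborel) * c"
    using sq_int sq_int' by (simp add: sq_eq sq_eq')
  finally have main: "(\<integral>t. (norm (fourier \<psi> (A * t)))\<^sup>2 \<partial>std_normal_distribution) \<le> (\<integral>y. (\<psi> y)\<^sup>2 \<partial>lborel) * c"
    unfolding fub' .
  define G where "G t = (norm (fourier \<psi> t))\<^sup>2" for t
  have Gm [measurable]: "G \<in> borel_measurable borel"
  proof -
    have "(\<lambda>t. G (A * t)) \<in> borel_measurable borel"
      using borel_measurable_integrable[OF wint] unfolding G_def by simp
    then have "(\<lambda>t. G (A * (t / A))) \<in> borel_measurable borel"
      by measurable
    then show ?thesis using A by simp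
  qed
  have dens: "integrable lborel (\<lambda>t. std_normal_density t * G (A * t))"
    "(\<integral>t. G (A * t) \<partial>std_normal_distribution) = (\<integral>t. std_normal_density t * G (A * t) \<partial>lborel)"
    using wint unfolding G_def[symmetric]
    by (simp_all add: integrable_density integral_density)
  \<comment> \<open>The minimum of the standard normal density on \<open>{-1..1}\<close>.\<close>
  define d where "d = exp (- 1 / 2) / sqrt (2 * pi)"
  have "(LINT t:{- A..A}|lborel. G t) = A * (\<integral>t. indicator {- A..A} (A * t) * G (A * t) \<partial>lborel)"
    using lborel_integral_real_affine[of A "\<lambda>t. indicator {- A..A} t * G t" 0] A
    unfolding set_lebesgue_integral_def by simp
  also have "\<dots> \<le> A * (\<integral>t. std_normal_density t * G (A * t) / d \<partial>lborel)"
  proof (intro mult_left_mono integral_mono')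
    show "integrable lborel (\<lambda>t. std_normal_density t * G (A * t) / d)" using dens(1) by simp
    fix t
    show "0 \<le> std_normal_density t * G (A * t) / d" unfolding G_def d_def by simp
    show "indicator {- A..A} (A * t) * G (A * t) \<le> std_normal_density t * G (A * t) / d"
    proof (cases "A * t \<in> {- A..A}")
      case True
      then have "\<bar>A * t\<bar> \<le> A" by auto
      then have "\<bar>t\<bar> \<le> 1" using A by (simp add: abs_mult)
      then have "t\<^sup>2 \<le> 1" by (simp add: abs_square_le_1)
      then have "d \<le> std_normal_density t"
        unfolding std_normal_density_def d_def by (simp add: divide_right_mono)
      then have "d * G (A * t) \<le> std_normal_density t * G (A * t)"
        by (rule mult_right_mono) (simp add: G_def)
      then show ?thesis using True unfolding d_def by (simp add: field_simps)
    next
      case False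
      then show ?thesis unfolding G_def d_def by simp
    qed
  qed (use A in auto)
  also have "\<dots> = A * ((\<integral>t. G (A * t) \<partial>std_normal_distribution) / d)"
    unfolding dens(2) by simp
  also have "\<dots> \<le> A * ((\<integral>y. (\<psi> y)\<^sup>2 \<partial>lborel) * c / d)"
    using main A unfolding G_def by (intro mult_left_mono divide_right_mono) (auto simp: d_def)
  also have "A * ((\<integral>y. (\<psi> y)\<^sup>2 \<partial>lborel) * c / d) = (sqrt (2 * pi))\<^sup>2 * exp (1 / 2) * (\<integral>y. (\<psi> y)\<^sup>2 \<partial>lborel)"
    using A unfolding c_def d_def exp_minus minus_divide_left[symmetric]
    by (simp add: field_simps power2_eq_square exp_minus del: real_sqrt_mult_self real_sqrt_mult_self)
  also have "(sqrt (2 * pi))\<^sup>2 = 2 * pi" by simp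
  finally show ?thesis unfolding G_def .
qed

section \<open>The zeta function in the right half-plane\<close>

text \<open>The terms of a series for \<open>(s - 1) * zeta s\<close> that converges for \<open>Re s > 0\<close>. They arise from
\<open>(s - 1) * (\<Sum>n<N. of_nat (Suc n) powr (- s)) + of_nat N powr (1 - s)\<close> as differences of consecutive values; the
last summand cancels the divergent part of the Dirichlet series.\<close>

definition zeta_num_term :: "nat \<Rightarrow> complex \<Rightarrow> complex" where
  "zeta_num_term n s = (of_nat n + s) * of_nat (Suc n) powr (- s) - of_nat n * of_nat n powr (- s)"

definition zeta_num :: "complex \<Rightarrow> complex" where
  "zeta_num s = (\<Sum>n. zeta_num_term n s)"

lemma of_nat_powr_eq_exp:
  fixes z :: complex
  assumes "0 < n"
  shows "of_nat n powr z = exp (z * of_real (ln (real n)))"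
  using assms Ln_of_real[of "real n"] by (simp add: powr_def)

lemma norm_of_nat_powr:
  fixes z :: complex
  assumes "0 < n"
  shows "norm (of_nat n powr z) = real n powr Re z"
  unfolding of_nat_powr_eq_exp[OF assms] norm_exp_eq_Re using assms by (simp add: powr_def)

lemma exp_one_minus_mult_ln:
  fixes s :: complex
  assumes "0 < n"
  shows "exp ((1 - s) * of_real (ln (real n))) = of_nat n * of_nat n powr (- s)"
proof -
  have "exp ((1 - s) * of_real (ln (real n))) = exp (of_real (ln (real n))) * exp (- s * of_real (ln (real n)))"
    unfolding exp_add[symmetric] by (rule arg_cong[of _ _ exp]) (simp add: algebra_simps)
  also have "exp (complex_of_real (ln (real n))) = of_nat n"
    using assms unfolding exp_of_real by simp
  also have "exp (- s * of_real (ln (real n))) = of_nat n powr (- s)"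
    using assms by (rule of_nat_powr_eq_exp[symmetric])
  finally show ?thesis .
qed

lemma borel_measurable_frac_exp [measurable]:
  "(\<lambda>y::real. frac (exp y)) \<in> borel_measurable borel"
proof -
  have "(\<lambda>y::real. exp y) \<in> borel_measurable borel"
    by (intro borel_measurable_continuous_onI continuous_intros)
  then show ?thesis
    unfolding frac_def by (intro borel_measurable_diff borel_measurable_real_floor[THEN measurable_compose[rotated]])
qed

text \<open>This integral representation serves twice: it shows that the terms decay like
\<open>n powr (- Re s - 1)\<close>, and its pieces add up to the Mellin transform of the fractional part.\<close>

lemma zeta_num_term_eq_integral:
  assumes n: "0 < n"
  shows "zeta_num_term n s =
    - s * (s - 1) * (LINT y:{ln n..ln (Suc n)}|lborel. of_real (frac (exp y)) * exp (- s * of_real y))"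
proof -
  define H where "H y = s * exp ((1 - s) * of_real y) + of_nat n * (1 - s) * exp (- s * of_real y)" for y :: real
  define h where "h y = - s * (s - 1) * (of_real (exp y - real n) * exp (- s * of_real y))" for y :: real
  have le: "ln (real n) \<le> ln (real (Suc n))" using n by simp
  have "(\<integral>y. indicator {ln n..ln (Suc n)} y *\<^sub>R h y \<partial>lborel) = H (ln (Suc n)) - H (ln n)"
  proof (rule integral_FTC_Icc[OF le])
    fix y :: real
    have "exp ((1 - s) * of_real y) = exp (of_real y) * exp (- s * of_real y)"
      unfolding exp_add[symmetric] by (rule arg_cong[of _ _ exp]) (simp add: algebra_simps)
    then have e: "exp ((1 - s) * of_real y) = of_real (exp y) * exp (- s * of_real y)"
      by (simp add: exp_of_real)
    have "((\<lambda>w. s * exp ((1 - s) * w) + of_nat n * (1 - s) * exp (- s * w)) has_field_derivative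
        s * ((1 - s) * exp ((1 - s) * of_real y)) + of_nat n * (1 - s) * (- s * exp (- s * of_real y))) (at (of_real y))"
      by (rule derivative_eq_intros refl)+ (simp add: mult_ac)
    then have "(H has_vector_derivative s * ((1 - s) * exp ((1 - s) * of_real y))
        + of_nat n * (1 - s) * (- s * exp (- s * of_real y))) (at y within {ln n..ln (Suc n)})"
      unfolding H_def by (rule has_vector_derivative_real_field)
    also have "s * ((1 - s) * exp ((1 - s) * of_real y)) + of_nat n * (1 - s) * (- s * exp (- s * of_real y)) = h y"
    proof -
      have "s * ((1 - s) * (a * X)) + m * (1 - s) * (- s * X) = - s * (s - 1) * ((a - m) * X)" for a m X :: complex
        by (simp add: algebra_simps)
      then show ?thesis unfolding h_def e of_real_diff of_real_of_nat_eq .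
    qed
    finally show "(H has_vector_derivative h y) (at y within {ln n..ln (Suc n)})" .
  next
    show "continuous_on {ln (real n)..ln (real (Suc n))} h"
      unfolding h_def by (intro continuous_intros)
  qed
  also have "H (ln (Suc n)) - H (ln n) = zeta_num_term n s"
  proof -
    have "s * ((1 + m) * X) + m * (1 - s) * X - (s * (m * Y) + m * (1 - s) * Y) = (m + s) * X - m * Y" for m X Y
      by (simp add: algebra_simps)
    then show ?thesis
      unfolding H_def zeta_num_term_def exp_one_minus_mult_ln[OF n] exp_one_minus_mult_ln[OF zero_less_Suc]
      unfolding of_nat_powr_eq_exp[OF n, symmetric] of_nat_powr_eq_exp[OF zero_less_Suc, symmetric]
      unfolding of_nat_Suc .
  qed
  finally have eq: "zeta_num_term n s = (LINT y:{ln n..ln (Suc n)}|lborel. h y)"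
    unfolding set_lebesgue_integral_def by (rule sym)
  \<comment> \<open>The integrands differ at the right end point only.\<close>
  have "(LINT y:{ln n..ln (Suc n)}|lborel. h y) =
     (LINT y:{ln n..ln (Suc n)}|lborel. - s * (s - 1) * (of_real (frac (exp y)) * exp (- s * of_real y)))"
    unfolding set_lebesgue_integral_def
  proof (rule integral_cong_AE)
    have "AE y in lborel. y \<noteq> ln (real (Suc n))" by (rule AE_lborel_singleton)
    then show "AE y in lborel. indicator {ln n..ln (Suc n)} y *\<^sub>R h y =
      indicator {ln n..ln (Suc n)} y *\<^sub>R (- s * (s - 1) * (of_real (frac (exp y)) * exp (- s * of_real y)))"
    proof eventually_elim
      case (elim y)
      show ?case
      proof (cases "y \<in> {ln n..ln (Suc n)}")
        case True
        then have "exp (ln (real n)) \<le> exp y" "exp y < exp (ln (real (Suc n)))"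
          unfolding exp_le_cancel_iff exp_less_cancel_iff using elim by simp_all
        then have "real n \<le> exp y" "exp y < real (Suc n)" using n by simp_all
        then have "\<lfloor>exp y\<rfloor> = int n" by (intro floor_unique) auto
        then show ?thesis unfolding h_def frac_def by simp
      qed simp
    qed
    have [measurable]: "(\<lambda>y. exp (- s * complex_of_real y)) \<in> borel_measurable borel"
      by (intro borel_measurable_continuous_onI continuous_intros)
    show "(\<lambda>y. indicator {ln (real n)..ln (real (Suc n))} y *\<^sub>R h y) \<in> borel_measurable lborel"
      unfolding h_def by measurable
    show "(\<lambda>y. indicator {ln (real n)..ln (real (Suc n))} y *\<^sub>R (- s * (s - 1) * (of_real (frac (exp y)) * exp (- s * of_real y)))) \<in> borel_measurable lborel"
      by measurable
  qed
  then show ?thesis unfolding eq set_integral_mult_right .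
qed

lemma norm_zeta_num_term_le:
  assumes n: "0 < n" and s: "0 \<le> Re s"
  shows "norm (zeta_num_term n s) \<le> norm s * norm (s - 1) * real n powr (- Re s - 1)"
proof -
  define h where "h y = of_real (frac (exp y)) * exp (- s * of_real y)" for y :: real
  have [measurable]: "(\<lambda>y. exp (- s * complex_of_real y)) \<in> borel_measurable borel"
    by (intro borel_measurable_continuous_onI continuous_intros)
  have hm: "h \<in> borel_measurable borel" unfolding h_def by measurable
  have le: "ln (real n) \<le> ln (real (Suc n))" using n by simp
  define c where "c = real n powr (- Re s)"
  have bnd: "norm (h y) \<le> c" if "ln (real n) \<le> y" for y
  proof -
    have "norm (h y) = frac (exp y) * exp (- Re s * y)"
      unfolding h_def norm_mult norm_exp_eq_Re by simp
    also have "\<dots> \<le> 1 * exp (- Re s * ln (real n))"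
      using that s frac_lt_1[of "exp y"] by (intro mult_mono) (auto intro: mult_left_mono)
    also have "\<dots> = c" using n unfolding c_def powr_def by simp
    finally show ?thesis .
  qed
  have ci: "integrable lborel (\<lambda>y. indicat_real {ln (real n)..ln (real (Suc n))} y *\<^sub>R c)"
    by (intro integrable_scaleR_left integrable_real_indicator) (use le in auto)
  have "norm (LINT y:{ln n..ln (Suc n)}|lborel. h y) \<le> (\<integral>y. indicat_real {ln (real n)..ln (real (Suc n))} y *\<^sub>R c \<partial>lborel)"
    unfolding set_lebesgue_integral_def
  proof (rule Bochner_Integration.integral_norm_bound_integral)
    show "integrable lborel (\<lambda>y. indicat_real {ln (real n)..ln (real (Suc n))} y *\<^sub>R h y)"
      by (rule Bochner_Integration.integrable_bound[OF ci]) (use hm bnd in \<open>auto simp: indicator_def c_def\<close>)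
    show "norm (indicat_real {ln (real n)..ln (real (Suc n))} y *\<^sub>R h y) \<le> indicat_real {ln (real n)..ln (real (Suc n))} y *\<^sub>R c" for y
      using bnd by (auto simp: indicator_def)
  qed (rule ci)
  also have "\<dots> = (ln (real (Suc n)) - ln (real n)) * c" using le by simp
  also have "\<dots> \<le> (1 / real n) * c"
  proof (rule mult_right_mono)
    have "ln (real (Suc n)) - ln (real n) = ln (1 + 1 / real n)"
    proof -
      have "1 + 1 / real n = real (Suc n) / real n" using n by (simp add: field_simps)
      then show ?thesis using n by (simp only:) (simp add: ln_div del: of_nat_Suc)
    qed
    also have "\<dots> \<le> 1 / real n" by (rule ln_add_one_self_le_self) simp
    finally show "ln (real (Suc n)) - ln (real n) \<le> 1 / real n" .
  qed (simp add: c_def)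
  also have "\<dots> = real n powr (- Re s - 1)"
    using n unfolding c_def by (simp add: powr_diff)
  finally have "norm (LINT y:{ln n..ln (Suc n)}|lborel. h y) \<le> real n powr (- Re s - 1)" .
  then have "norm s * norm (s - 1) * norm (LINT y:{ln n..ln (Suc n)}|lborel. h y) \<le> norm s * norm (s - 1) * real n powr (- Re s - 1)"
    by (intro mult_left_mono) auto
  then show ?thesis
    unfolding zeta_num_term_eq_integral[OF n] h_def[symmetric] norm_mult by simp
qed

lemma zeta_num_term_0: "zeta_num_term 0 s = s"
  unfolding zeta_num_term_def by simp

lemma zeta_num_uniform_limit:
  assumes "0 < d"
  shows "uniform_limit {s. d \<le> Re s \<and> norm s \<le> R} (\<lambda>N s. \<Sum>n<N. zeta_num_term n s) zeta_num sequentially"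
  unfolding zeta_num_def
proof (rule Weierstrass_m_test)
  \<comment> \<open>The term with index \<open>0\<close> equals \<open>s\<close> and is outside the general estimate.\<close>
  define M where "M n = (if n = 0 then R else R * (R + 1) * real n powr (- d - 1))" for n
  have sm: "summable (\<lambda>n. real n powr (- d - 1))"
    using assms by (simp add: summable_real_powr_iff)
  show "summable M"
  proof (rule summable_cong[THEN iffD1])
    show "\<forall>\<^sub>F n in sequentially. R * (R + 1) * real n powr (- d - 1) = M n"
      using eventually_gt_at_top[of 0] by eventually_elim (simp add: M_def)
    show "summable (\<lambda>n. R * (R + 1) * real n powr (- d - 1))" using sm by (rule summable_mult)
  qed
  fix n s assume s: "s \<in> {s. d \<le> Re s \<and> norm s \<le> R}"
  show "norm (zeta_num_term n s) \<le> M n"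
  proof (cases "n = 0")
    case True
    then show ?thesis using s by (simp add: zeta_num_term_0 M_def)
  next
    case False
    have "norm (zeta_num_term n s) \<le> norm s * norm (s - 1) * real n powr (- Re s - 1)"
      using False s assms by (intro norm_zeta_num_term_le) auto
    also have "\<dots> \<le> R * (R + 1) * real n powr (- d - 1)"
    proof (intro mult_mono)
      show "norm (s - 1) \<le> R + 1" using s norm_triangle_ineq4[of s 1] by auto
      show "real n powr (- Re s - 1) \<le> real n powr (- d - 1)"
        using s False by (intro powr_mono) auto
      show "0 \<le> R" using order_trans[OF norm_ge_zero, of s R] s by simp
      then show "0 \<le> R * (R + 1)" by simp
    qed (use s in auto)
    finally show ?thesis using False by (simp add: M_def)
  qed
qed

lemma zeta_num_sums:
  assumes "0 < Re s"
  shows "(\<lambda>n. zeta_num_term n s) sums zeta_num s"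
  unfolding sums_def
  using tendsto_uniform_limitI[OF zeta_num_uniform_limit[OF assms, of "norm s"], of s] by simp

lemma zeta_num_holomorphic: "zeta_num holomorphic_on {s. 0 < Re s}"
proof (rule holomorphic_uniform_sequence)
  show "open {s. 0 < Re s}" by (rule open_halfspace_Re_gt)
  show "(\<lambda>s. \<Sum>n<N. zeta_num_term n s) holomorphic_on {s. 0 < Re s}" for N
    unfolding zeta_num_term_def
    by (intro holomorphic_intros)
  fix s :: complex assume s: "s \<in> {s. 0 < Re s}"
  define d where "d = Re s / 2"
  have d: "0 < d" using s unfolding d_def by simp
  have sub: "cball s d \<subseteq> {z. d \<le> Re z \<and> norm z \<le> norm s + d}"
  proof
    fix z assume "z \<in> cball s d"
    then have z: "norm (z - s) \<le> d" by (simp add: dist_norm norm_minus_commute)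
    have "\<bar>Re z - Re s\<bar> \<le> d" using abs_Re_le_cmod[of "z - s"] z by simp
    then have "d \<le> Re z" unfolding d_def by linarith
    moreover have "norm z \<le> norm s + d" using z norm_triangle_ineq[of "z - s" s] by simp
    ultimately show "z \<in> {z. d \<le> Re z \<and> norm z \<le> norm s + d}" by simp
  qed
  show "\<exists>d>0. cball s d \<subseteq> {s. 0 < Re s} \<and>
      uniform_limit (cball s d) (\<lambda>N s. \<Sum>n<N. zeta_num_term n s) zeta_num sequentially"
    using d sub uniform_limit_on_subset[OF zeta_num_uniform_limit[OF d] sub] by (intro exI[of _ d]) auto
qed

lemma sum_zeta_num_term:
  "(\<Sum>n<N. zeta_num_term n s) = (s - 1) * (\<Sum>n<N. of_nat (Suc n) powr (- s)) + of_nat N * of_nat N powr (- s)"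
proof (induction N)
  case (Suc N)
  have "(s - 1) * S + Y + ((m + s) * X - Y) = (s - 1) * (S + X) + (1 + m) * X" for m X Y S
    by (simp add: algebra_simps)
  then show ?case
    unfolding sum.lessThan_Suc Suc unfolding zeta_num_term_def of_nat_Suc .
qed simp

lemma dirichlet_series_summable:
  assumes "1 < Re s"
  shows "summable (\<lambda>n. norm (of_nat (Suc n) powr (- s) :: complex))"
proof -
  have "norm (of_nat (Suc n) powr (- s) :: complex) = real (Suc n) powr (- Re s)" for n
    by (subst norm_of_nat_powr) auto
  moreover have "summable (\<lambda>n. real (Suc n) powr (- Re s))"
    using assms by (subst summable_Suc_iff) (simp add: summable_real_powr_iff)
  ultimately show ?thesis by (simp only:)
qed

lemma zeta_continuation_zeta_num: "zeta_continuation 0 (\<lambda>s. zeta_num s / (s - 1))"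
  unfolding zeta_continuation_def
proof (intro conjI allI impI)
  show "(\<lambda>s. zeta_num s / (s - 1)) holomorphic_on {z. 0 < Re z} - {1}"
    by (intro holomorphic_intros holomorphic_on_subset[OF zeta_num_holomorphic]) auto
  fix s :: complex assume s: "1 < Re s"
  then have s1: "s \<noteq> 1" by auto
  have "(\<lambda>N. of_nat N * of_nat N powr (- s)) \<longlonglongrightarrow> 0"
  proof (rule Lim_null_comparison)
    show "\<forall>\<^sub>F N in sequentially. norm (of_nat N * of_nat N powr (- s)) \<le> real N powr (1 - Re s)"
      using eventually_gt_at_top[of 0]
    proof eventually_elim
      case (elim N)
      have "norm (of_nat N powr (- s) :: complex) = real N powr (- Re s)"
        using elim by (subst norm_of_nat_powr) auto
      then have "norm (of_nat N * of_nat N powr (- s) :: complex) = real N powr 1 * real N powr (- Re s)"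
        using elim by (simp only: norm_mult norm_of_nat) simp
      then show ?case unfolding powr_add[symmetric] by simp
    qed
    show "(\<lambda>N. real N powr (1 - Re s)) \<longlonglongrightarrow> 0"
      using s by (intro tendsto_neg_powr filterlim_real_sequentially) auto
  qed
  then have "(\<lambda>N. ((\<Sum>n<N. zeta_num_term n s) - of_nat N * of_nat N powr (- s)) / (s - 1)) \<longlonglongrightarrow> (zeta_num s - 0) / (s - 1)"
    using zeta_num_sums[of s] s s1 unfolding sums_def by (intro tendsto_intros) auto
  then show "(\<lambda>n. of_nat (Suc n) powr (- s)) sums (zeta_num s / (s - 1))"
    unfolding sums_def sum_zeta_num_term using s1 by simp
qed

lemma zeta_eq_zeta_num: "0 < Re s \<Longrightarrow> s \<noteq> 1 \<Longrightarrow> zeta s = zeta_num s / (s - 1)"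
  by (rule zeta_eqI[OF zeta_continuation_zeta_num])

lemma zeta_sums:
  assumes "1 < Re s"
  shows "(\<lambda>n. of_nat (Suc n) powr (- s)) sums zeta s"
proof -
  have "zeta s = zeta_num s / (s - 1)" using assms by (intro zeta_eq_zeta_num) auto
  then show ?thesis using zeta_continuation_zeta_num assms unfolding zeta_continuation_def by simp
qed

text \<open>The bound is kept in the form \<open>norm s * \<dots>\<close> so that division by \<open>s + 1\<close> leaves only the
factor that is linear in \<open>s - 1\<close>.\<close>

lemma zeta_num_growth:
  "\<exists>C\<ge>0. \<forall>s. 1 / 2 \<le> Re s \<longrightarrow> norm (zeta_num s) \<le> norm s * (1 + C * norm (s - 1))"
proof -
  define C where "C = (\<Sum>n. real (Suc n) powr (- 3 / 2))"
  have sm: "summable (\<lambda>n. real (Suc n) powr (- 3 / 2))"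
    by (subst summable_Suc_iff) (simp add: summable_real_powr_iff)
  have "norm (zeta_num s) \<le> norm s * (1 + C * norm (s - 1))" if s: "1 / 2 \<le> Re s" for s
  proof -
    have "(\<lambda>n. zeta_num_term (Suc n) s) sums (zeta_num s - zeta_num_term 0 s)"
      using zeta_num_sums[of s] s by (subst sums_Suc_iff) auto
    then have eq: "zeta_num s = s + (\<Sum>n. zeta_num_term (Suc n) s)"
      by (simp add: sums_iff zeta_num_term_0)
    have le: "norm (zeta_num_term (Suc n) s) \<le> norm s * norm (s - 1) * real (Suc n) powr (- 3 / 2)" for n
    proof -
      have "norm (zeta_num_term (Suc n) s) \<le> norm s * norm (s - 1) * real (Suc n) powr (- Re s - 1)"
        using s by (intro norm_zeta_num_term_le) auto
      also have "\<dots> \<le> norm s * norm (s - 1) * real (Suc n) powr (- 3 / 2)"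
        using s by (intro mult_left_mono powr_mono) auto
      finally show ?thesis .
    qed
    have sm': "summable (\<lambda>n. norm s * norm (s - 1) * real (Suc n) powr (- 3 / 2))"
      using sm by (rule summable_mult)
    have "norm (\<Sum>n. zeta_num_term (Suc n) s) \<le> (\<Sum>n. norm s * norm (s - 1) * real (Suc n) powr (- 3 / 2))"
      using le by (intro norm_suminf_le sm') 
    also have "\<dots> = norm s * norm (s - 1) * C"
      unfolding C_def using sm by (rule suminf_mult)
    finally have "norm (zeta_num s) \<le> norm s + norm s * norm (s - 1) * C"
      unfolding eq using norm_triangle_ineq[of s "\<Sum>n. zeta_num_term (Suc n) s"] by linarith
    then show ?thesis by (simp add: algebra_simps)
  qed
  moreover have "0 \<le> C" unfolding C_def by (intro suminf_nonneg sm) auto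
  ultimately show ?thesis by blast
qed

lemma norm_zeta_le_real_series:
  assumes "1 < Re s"
  shows "norm (zeta s) \<le> (\<Sum>n. real (Suc n) powr (- Re s))"
    and "summable (\<lambda>n. real (Suc n) powr (- Re s))"
proof -
  have eq: "norm (of_nat (Suc n) powr (- s) :: complex) = real (Suc n) powr (- Re s)" for n
    by (subst norm_of_nat_powr) auto
  show sm: "summable (\<lambda>n. real (Suc n) powr (- Re s))"
    using dirichlet_series_summable[OF assms] unfolding eq .
  have "norm (\<Sum>n. of_nat (Suc n) powr (- s) :: complex) \<le> (\<Sum>n. real (Suc n) powr (- Re s))"
    by (rule norm_suminf_le) (simp_all only: eq sm order_refl)
  then show "norm (zeta s) \<le> (\<Sum>n. real (Suc n) powr (- Re s))"
    using zeta_sums[OF assms] by (simp only: sums_iff)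
qed

text \<open>The terms after the first are compared with half of the telescoping series of
\<open>1 / (n * (n + 1))\<close>.\<close>

lemma norm_zeta_ge_half:
  assumes s: "3 \<le> Re s"
  shows "1 / 2 \<le> norm (zeta s)"
proof -
  have "(\<lambda>n. of_nat (Suc (Suc n)) powr (- s)) sums (zeta s - of_nat (Suc 0) powr (- s))"
    using zeta_sums[of s] s by (subst sums_Suc_iff) auto
  then have eq: "zeta s - 1 = (\<Sum>n. of_nat (Suc (Suc n)) powr (- s))"
    by (simp add: sums_iff)
  have tel: "(\<lambda>n. 1 / 2 * (inverse (real (Suc n)) - inverse (real (Suc (Suc n))))) sums (1 / 2 * (inverse (real (Suc 0)) - 0))"
    by (intro sums_mult telescope_sums' LIMSEQ_inverse_real_of_nat)
  have le: "norm (of_nat (Suc (Suc n)) powr (- s) :: complex) \<le> 1 / 2 * (inverse (real (Suc n)) - inverse (real (Suc (Suc n))))" for n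
  proof -
    have "norm (of_nat (Suc (Suc n)) powr (- s) :: complex) = real (Suc (Suc n)) powr (- Re s)"
      by (subst norm_of_nat_powr) auto
    also have "\<dots> \<le> real (Suc (Suc n)) powr (- 3)" using s by (intro powr_mono) auto
    also have "\<dots> = inverse (real (Suc (Suc n)) ^ 3)"
      by (subst powr_minus) (simp only: powr_numeral of_nat_0_le_iff)
    also have "\<dots> \<le> inverse (2 * (real (Suc n) * real (Suc (Suc n))))"
    proof (rule le_imp_inverse_le)
      have "2 * (real (Suc n) * real (Suc (Suc n))) \<le> real (Suc (Suc n)) * (real (Suc (Suc n)) * real (Suc (Suc n)))"
        by (intro mult_mono) auto
      then show "2 * (real (Suc n) * real (Suc (Suc n))) \<le> real (Suc (Suc n)) ^ 3"
        by (simp only: power3_eq_cube mult.assoc)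
    qed simp
    also have "\<dots> = 1 / 2 * (inverse (real (Suc n)) - inverse (real (Suc (Suc n))))"
      by (simp add: field_simps)
    finally show ?thesis .
  qed
  have "norm (zeta s - 1) \<le> (\<Sum>n. 1 / 2 * (inverse (real (Suc n)) - inverse (real (Suc (Suc n)))))"
    unfolding eq using le by (intro norm_suminf_le sums_summable[OF tel])
  also have "\<dots> = 1 / 2" using sums_unique[OF tel] by simp
  finally show ?thesis
    using norm_triangle_ineq2[of 1 "1 - zeta s"] by (simp add: norm_minus_commute)
qed

lemma norm_zeta_cnj:
  assumes "0 < Re s" "s \<noteq> 1"
  shows "norm (zeta (cnj s)) = norm (zeta s)"
proof -
  have powr: "of_nat n powr (- cnj s) = cnj (of_nat n powr (- s))" for n
    by (cases "n = 0") (simp_all add: of_nat_powr_eq_exp exp_cnj)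
  have "zeta_num_term n (cnj s) = cnj (zeta_num_term n s)" for n
    unfolding zeta_num_term_def powr by simp
  then have "(\<lambda>n. zeta_num_term n (cnj s)) sums cnj (zeta_num s)"
    using zeta_num_sums[OF assms(1)] by (simp only: sums_cnj)
  then have "zeta_num (cnj s) = cnj (zeta_num s)"
    unfolding zeta_num_def by (rule sums_unique[symmetric])
  moreover have "cnj s \<noteq> 1" using assms(2) complex_cnj_one_iff by blast
  ultimately have "zeta (cnj s) = cnj (zeta s)"
    using assms by (simp add: zeta_eq_zeta_num)
  then show ?thesis by simp
qed

lemma integrable_two_sided_exp:
  fixes p q :: real
  assumes "0 < p" "0 < q"
  shows "integrable lborel (\<lambda>y::real. indicator {..0} y * exp (p * y) + indicator {0..} y * exp (- q * y))"
proof -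
  have half: "integrable lborel (\<lambda>y::real. indicator {0..} y * exp (- r * y))" if "0 < r" for r :: real
  proof -
    have "(\<lambda>y::real. exp (- r * y)) absolutely_integrable_on {0..}"
      using integrable_on_exp_minus_to_infinity[OF that, of 0]
      by (intro nonnegative_absolutely_integrable_1) auto
    then have "integrable lebesgue (\<lambda>y::real. indicator {0..} y * exp (- r * y))"
      unfolding set_integrable_def by simp
    moreover have "(\<lambda>y::real. indicator {0..} y * exp (- r * y)) \<in> borel_measurable lborel"
      by measurable
    ultimately show ?thesis by (simp add: integrable_completion)
  qed
  have "integrable lborel (\<lambda>y::real. indicator {0..} (0 + (-1) * y) * exp (- p * (0 + (-1) * y)))"
    by (rule lborel_integrable_real_affine[OF half[OF assms(1)]]) simp
  also have "(\<lambda>y::real. indicator {0..} (0 + (-1) * y) * exp (- p * (0 + (-1) * y))) = (\<lambda>y. indicator {..0} y * exp (p * y))"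
    by (auto simp: indicator_def)
  finally show ?thesis using half[OF assms(2)] by (rule Bochner_Integration.integrable_add)
qed

lemma frac_exp_le: "\<bar>frac (exp y)\<bar> \<le> indicator {..0} y * exp y + indicator {0..} y" for y :: real
proof (cases "y \<le> 0")
  case True
  have "frac (exp y) \<le> exp y" unfolding frac_def by simp
  then show ?thesis using True by (auto simp: indicator_def)
next
  case False
  then show ?thesis using frac_lt_1[of "exp y"] by (auto simp: indicator_def)
qed

lemma integrable_frac_exp:
  assumes s: "0 < Re s" "Re s < 1"
  shows "integrable lborel (\<lambda>y. of_real (frac (exp y)) * exp (- s * of_real y))"
proof (rule Bochner_Integration.integrable_bound)
  show "integrable lborel (\<lambda>y::real. indicator {..0} y * exp ((1 - Re s) * y) + indicator {0..} y * exp (- Re s * y))"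
    using s by (intro integrable_two_sided_exp) auto
  have [measurable]: "(\<lambda>y. exp (- s * complex_of_real y)) \<in> borel_measurable borel"
    by (intro borel_measurable_continuous_onI continuous_intros)
  show "(\<lambda>y. complex_of_real (frac (exp y)) * exp (- s * complex_of_real y)) \<in> borel_measurable lborel"
    by measurable
  have "norm (complex_of_real (frac (exp y)) * exp (- s * complex_of_real y))
      \<le> indicator {..0} y * exp ((1 - Re s) * y) + indicator {0..} y * exp (- Re s * y)" for y
  proof -
    have "norm (complex_of_real (frac (exp y)) * exp (- s * complex_of_real y)) = \<bar>frac (exp y)\<bar> * exp (- Re s * y)"
      unfolding norm_mult norm_exp_eq_Re by simp
    also have "\<dots> \<le> (indicator {..0} y * exp y + indicator {0..} y) * exp (- Re s * y)"
      using frac_exp_le by (rule mult_right_mono) simp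
    also have "\<dots> = indicator {..0} y * exp ((1 - Re s) * y) + indicator {0..} y * exp (- Re s * y)"
      by (simp add: algebra_simps flip: exp_add)
    finally show ?thesis .
  qed
  then show "AE y in lborel. norm (complex_of_real (frac (exp y)) * exp (- s * complex_of_real y))
      \<le> norm (indicator {..0} y * exp ((1 - Re s) * y) + indicator {0..} y * exp (- Re s * y))"
    by (intro AE_I2) (simp add: order_trans[OF _ abs_ge_self])
qed

text \<open>In the variable \<open>x = exp y\<close> this is the classical formula
\<open>zeta s = - s * (integral from 0 to infinity of frac x * x powr (- s - 1))\<close>. The part \<open>x < 1\<close>
contributes \<open>s / (s - 1)\<close>, the value of the zeroth term of the series for \<open>zeta_num\<close> divided by \<open>s - 1\<close>, and the
interval from \<open>n\<close> to \<open>n + 1\<close> contributes the \<open>n\<close>-th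
term divided by \<open>s - 1\<close>.\<close>

lemma zeta_Mellin:
  assumes s: "0 < Re s" "Re s < 1"
  shows "zeta s = - s * (\<integral>y. of_real (frac (exp y)) * exp (- s * of_real y) \<partial>lborel)"
proof -
  define h where "h y = of_real (frac (exp y)) * exp (- s * of_real y)" for y :: real
  have h: "integrable lborel h" unfolding h_def by (rule integrable_frac_exp[OF s])
  have hs: "set_integrable lborel A h" if "A \<in> sets borel" for A
    using h that unfolding set_integrable_def by (intro integrable_mult_indicator) auto
  define w where "w = 1 - s"
  have w: "0 < Re w" "w \<noteq> 0" using s unfolding w_def by auto
  have neg: "(LINT y:{- M..0}|lborel. h y) = (1 - exp (- w * of_real M)) / w" if M: "0 \<le> M" for M :: real
  proof -
    have "(\<integral>y. indicator {- M..0} y *\<^sub>R exp (w * of_real y) \<partial>lborel) = exp (w * of_real 0) / w - exp (w * of_real (- M)) / w"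
    proof (rule integral_FTC_Icc)
      show "- M \<le> 0" using M by simp
      fix y :: real
      have "((\<lambda>z. exp (w * z) / w) has_field_derivative exp (w * of_real y)) (at (of_real y))"
        using w by (auto intro!: derivative_eq_intros)
      then show "((\<lambda>y. exp (w * of_real y) / w) has_vector_derivative exp (w * of_real y)) (at y within {- M..0})"
        by (rule has_vector_derivative_real_field)
    qed (intro continuous_intros)
    also have "(\<integral>y. indicator {- M..0} y *\<^sub>R exp (w * of_real y) \<partial>lborel) = (LINT y:{- M..0}|lborel. h y)"
      unfolding set_lebesgue_integral_def
    proof (rule integral_cong_AE)
      have "AE y in lborel. y \<noteq> (0::real)" by (rule AE_lborel_singleton)
      then show "AE y in lborel. indicator {- M..0} y *\<^sub>R exp (w * of_real y) = indicator {- M..0} y *\<^sub>R h y"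
      proof eventually_elim
        case (elim y)
        show ?case
        proof (cases "y < 0")
          case True
          then have "frac (exp y) = exp y" by (simp add: frac_eq)
          then have "h y = exp (of_real y) * exp (- s * of_real y)" unfolding h_def by (simp add: exp_of_real)
          also have "\<dots> = exp (w * of_real y)"
            unfolding exp_add[symmetric] w_def by (rule arg_cong[of _ _ exp]) (simp add: algebra_simps)
          finally show ?thesis by simp
        next
          case False
          then show ?thesis using elim by (simp add: indicator_def)
        qed
      qed
      have [measurable]: "(\<lambda>y. exp (w * complex_of_real y)) \<in> borel_measurable borel"
        by (intro borel_measurable_continuous_onI continuous_intros)
      show "(\<lambda>y. indicator {- M..0} y *\<^sub>R exp (w * of_real y)) \<in> borel_measurable lborel" by measurable
      show "(\<lambda>y. indicator {- M..0} y *\<^sub>R h y) \<in> borel_measurable lborel"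
        using hs[of "{- M..0}"] unfolding set_integrable_def by auto
    qed
    finally show ?thesis by (simp add: diff_divide_distrib)
  qed
  have union: "(LINT y:{a..c}|lborel. h y) = (LINT y:{a..b}|lborel. h y) + (LINT y:{b..c}|lborel. h y)"
    if "a \<le> b" "b \<le> c" for a b c :: real
  proof -
    have "(LINT y:{a..b} \<union> {b..c}|lborel. h y) = (LINT y:{a..b}|lborel. h y) + (LINT y:{b..c}|lborel. h y)"
    proof (rule set_integral_Un_AE)
      have "AE y in lborel. y \<noteq> b" by (rule AE_lborel_singleton)
      then show "AE y in lborel. \<not> (y \<in> {a..b} \<and> y \<in> {b..c})" by eventually_elim auto
    qed (use hs in auto)
    then show ?thesis using that by (simp add: ivl_disj_un_two_touch)
  qed
  have pos: "- s * (s - 1) * (LINT y:{0..ln (Suc N)}|lborel. h y) = (\<Sum>n<N. zeta_num_term (Suc n) s)" for N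
  proof (induction N)
    case 0
    have "AE y in lborel. indicator {0..ln (real (Suc 0))} y *\<^sub>R h y = 0"
      using AE_lborel_singleton[of 0] by eventually_elim (auto simp: indicator_def)
    then show ?case unfolding set_lebesgue_integral_def by (simp add: integral_eq_zero_AE)
  next
    case (Suc N)
    have "(LINT y:{0..ln (Suc (Suc N))}|lborel. h y)
        = (LINT y:{0..ln (Suc N)}|lborel. h y) + (LINT y:{ln (Suc N)..ln (Suc (Suc N))}|lborel. h y)"
      by (intro union) auto
    moreover have "zeta_num_term (Suc N) s = - s * (s - 1) * (LINT y:{ln (Suc N)..ln (Suc (Suc N))}|lborel. h y)"
      unfolding zeta_num_term_eq_integral[OF zero_less_Suc] h_def ..
    ultimately show ?case
      using Suc by (simp only: sum.lessThan_Suc distrib_left)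
  qed
  have step: "- s * (s - 1) * (LINT y:{- real N..ln (Suc N)}|lborel. h y) = s * (1 - exp (- w * of_real N)) + (\<Sum>n<N. zeta_num_term (Suc n) s)" for N
  proof -
    have "(LINT y:{- real N..ln (Suc N)}|lborel. h y) = (LINT y:{- real N..0}|lborel. h y) + (LINT y:{0..ln (Suc N)}|lborel. h y)"
      by (intro union) auto
    moreover have "- s * (s - 1) * ((1 - E) / w) = s * (1 - E)" for E
      using w unfolding w_def by (simp add: field_simps)
    ultimately show ?thesis
      unfolding pos[symmetric] using neg[of "real N"] by (simp only: distrib_left of_nat_0_le_iff of_real_of_nat_eq)
  qed
  have lim1: "(\<lambda>N. LINT y:{- real N..ln (Suc N)}|lborel. h y) \<longlonglongrightarrow> (\<integral>y. h y \<partial>lborel)"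
    unfolding set_lebesgue_integral_def
  proof (rule integral_dominated_convergence[where w = "\<lambda>y. norm (h y)"])
    show "AE y in lborel. (\<lambda>N. indicator {- real N..ln (real (Suc N))} y *\<^sub>R h y) \<longlonglongrightarrow> h y"
    proof (rule AE_I2)
      fix y :: real
      have 1: "\<forall>\<^sub>F N in sequentially. real N \<ge> \<bar>y\<bar> + exp y"
        using filterlim_real_sequentially by (simp add: filterlim_at_top)
      then have "\<forall>\<^sub>F N in sequentially. indicator {- real N..ln (real (Suc N))} y *\<^sub>R h y = h y"
      proof eventually_elim
        case (elim N)
        have "- real N \<le> y" using elim exp_gt_zero[of y] by linarith
        moreover have "exp y \<le> real (Suc N)" using elim abs_ge_zero[of y] by simp
        then have "y \<le> ln (real (Suc N))" by (subst ln_ge_iff) auto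
        ultimately show ?case by simp
      qed
      then show "(\<lambda>N. indicator {- real N..ln (real (Suc N))} y *\<^sub>R h y) \<longlonglongrightarrow> h y"
        by (rule tendsto_eventually)
    qed
    show "integrable lborel (\<lambda>y. norm (h y))" using h by simp
    show "h \<in> borel_measurable lborel" using h by simp
    show "(\<lambda>y. indicator {- real N..ln (real (Suc N))} y *\<^sub>R h y) \<in> borel_measurable lborel" for N
      using hs[of "{- real N..ln (real (Suc N))}"] unfolding set_integrable_def by auto
    show "AE y in lborel. norm (indicator {- real N..ln (real (Suc N))} y *\<^sub>R h y) \<le> norm (h y)" for N
      by (intro AE_I2) (auto simp: indicator_def)
  qed
  have "(\<lambda>N. exp (- w * of_real (real N))) \<longlonglongrightarrow> 0"
  proof (rule tendsto_norm_zero_cancel)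
    have "(\<lambda>N. exp (- Re w) ^ N) \<longlonglongrightarrow> 0" using w by (intro LIMSEQ_power_zero) simp
    then show "(\<lambda>N. norm (exp (- w * of_real (real N)))) \<longlonglongrightarrow> 0"
      unfolding norm_exp_eq_Re by (simp add: exp_of_nat_mult[symmetric] mult.commute)
  qed
  then have "(\<lambda>N. s * (1 - exp (- w * of_real (real N))) + (\<Sum>n<N. zeta_num_term (Suc n) s)) \<longlonglongrightarrow>
      s * (1 - 0) + (zeta_num s - zeta_num_term 0 s)"
  proof (intro tendsto_intros)
    have "(\<lambda>n. zeta_num_term (Suc n) s) sums (zeta_num s - zeta_num_term 0 s)"
      using zeta_num_sums[OF s(1)] by (subst sums_Suc_iff) auto
    then show "(\<lambda>N. \<Sum>n<N. zeta_num_term (Suc n) s) \<longlonglongrightarrow> zeta_num s - zeta_num_term 0 s"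
      unfolding sums_def .
  qed
  moreover have "(\<lambda>N. - s * (s - 1) * (LINT y:{- real N..ln (Suc N)}|lborel. h y)) \<longlonglongrightarrow> - s * (s - 1) * (\<integral>y. h y \<partial>lborel)"
    using lim1 by (intro tendsto_intros)
  ultimately have "- s * (s - 1) * (\<integral>y. h y \<partial>lborel) = zeta_num s"
    unfolding step zeta_num_term_0 using LIMSEQ_unique by fastforce
  moreover have "s \<noteq> 1" "s \<noteq> 0" using s by auto
  ultimately show ?thesis
    unfolding h_def[symmetric] by (simp add: zeta_eq_zeta_num s(1)) (simp add: field_simps)
qed

section \<open>The second moment of zeta to the right of the critical line\<close>

lemma zeta_holomorphic: "zeta holomorphic_on {s. 0 < Re s} - {1}"
proof -
  have "(\<lambda>s. zeta_num s / (s - 1)) holomorphic_on {s. 0 < Re s} - {1}"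
    using zeta_continuation_zeta_num unfolding zeta_continuation_def by simp
  then show ?thesis
    by (rule holomorphic_transform) (auto simp: zeta_eq_zeta_num)
qed

lemma continuous_zeta_vertical:
  assumes "0 < \<sigma>" "\<sigma> \<noteq> 1"
  shows "continuous_on UNIV (\<lambda>t. zeta (Complex \<sigma> t))"
proof -
  have "continuous_on UNIV (\<lambda>t. zeta (of_real \<sigma> + \<i> * of_real t))"
    using assms
    by (intro continuous_on_compose2[OF holomorphic_on_imp_continuous_on[OF zeta_holomorphic]] continuous_intros)
       (auto simp: complex_eq_iff)
  then show ?thesis by (simp add: Complex_eq)
qed

lemma norm_exp_minus_one_ge:
  fixes w :: complex
  assumes "norm w \<le> 1 / 4"
  shows "norm w / 2 \<le> norm (exp w - 1)"
proof -
  have "norm ((exp w - w) - (exp 0 - 0)) \<le> 2 * norm w * norm (w - 0)"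
  proof (rule field_differentiable_bound[of "cball 0 (norm w)" _ "\<lambda>z. exp z - 1"])
    fix z :: complex assume z: "z \<in> cball 0 (norm w)"
    show "((\<lambda>z. exp z - z) has_field_derivative exp z - 1) (at z within cball 0 (norm w))"
      by (auto intro!: derivative_eq_intros)
    have "norm (exp z - 1) \<le> 2 * norm z"
    proof -
      have "norm (exp z - exp 0) \<le> 2 * norm (z - 0)"
      proof (rule field_differentiable_bound[of "cball 0 (1 / 2)" _ exp])
        show "norm (exp u) \<le> 2" if "u \<in> cball 0 (1 / 2)" for u :: complex
          using that by (intro exp_bound_half) simp
      qed (use z assms in \<open>auto intro!: derivative_eq_intros\<close>)
      then show ?thesis by simp
    qed
    then show "norm (exp z - 1) \<le> 2 * norm w" using z by auto
  qed auto
  also have "\<dots> \<le> norm w / 2"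
    using mult_left_mono[OF assms, of "2 * norm w"] by simp
  finally have "norm (exp w - 1 - w) \<le> norm w / 2" by (simp add: algebra_simps)
  then show ?thesis using norm_triangle_ineq2[of w "w - (exp w - 1)"] by (simp add: norm_minus_commute algebra_simps)
qed

text \<open>The weight \<open>exp (- \<sigma> * y)\<close> makes the Fourier transform of this function the Laplace transform on
the line \<open>Re s = \<sigma>\<close>.\<close>

definition frac_diff :: "real \<Rightarrow> real \<Rightarrow> real \<Rightarrow> real" where
  "frac_diff \<sigma> h y = (frac (exp (y + h)) - frac (exp y)) * exp (- \<sigma> * y)"

lemma fourier_frac_diff:
  assumes \<sigma>: "0 < \<sigma>" "\<sigma> < 1"
  shows "integrable lborel (frac_diff \<sigma> h)"
    and "fourier (frac_diff \<sigma> h) t = - (exp (of_real h * Complex \<sigma> t) - 1) * zeta (Complex \<sigma> t) / Complex \<sigma> t"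
proof -
  define e where "e s y = of_real (frac (exp y)) * exp (- s * of_real y)" for s :: complex and y :: real
  have e: "integrable lborel (e s)" if "Re s = \<sigma>" for s
    unfolding e_def using that \<sigma> by (intro integrable_frac_exp) auto
  have shift: "integrable lborel (\<lambda>y. e s (y + h))" "(\<integral>y. e s (y + h) \<partial>lborel) = (\<integral>y. e s y \<partial>lborel)"
    if "Re s = \<sigma>" for s
    using lborel_integrable_real_affine[OF e[OF that], of 1 h] lborel_integral_real_affine[of 1 "e s" h]
    by (simp_all add: add.commute)
  have split: "of_real (frac_diff \<sigma> h y) * iexp (- (t * y)) = exp (of_real h * Complex \<sigma> t) * e (Complex \<sigma> t) (y + h) - e (Complex \<sigma> t) y" for t y
  proof -
    define s where "s = Complex \<sigma> t"
    have s: "s = of_real \<sigma> + \<i> * of_real t" unfolding s_def by (simp add: Complex_eq)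
    have "exp (of_real (- \<sigma> * y)) * iexp (- (t * y)) = exp (- s * of_real y)"
      unfolding exp_add[symmetric] s by (rule arg_cong[of _ _ exp]) (simp add: algebra_simps)
    then have 1: "complex_of_real (exp (- \<sigma> * y)) * iexp (- (t * y)) = exp (- s * of_real y)"
      by (simp only: exp_of_real)
    have 2: "exp (of_real h * s) * exp (- s * of_real (y + h)) = exp (- s * of_real y)"
      unfolding exp_add[symmetric] by (rule arg_cong[of _ _ exp]) (simp add: algebra_simps)
    have "of_real (frac_diff \<sigma> h y) * iexp (- (t * y))
        = (of_real (frac (exp (y + h))) - of_real (frac (exp y))) * (complex_of_real (exp (- \<sigma> * y)) * iexp (- (t * y)))"
      unfolding frac_diff_def of_real_mult of_real_diff by (simp only: mult.assoc)
    also have "\<dots> = of_real (frac (exp (y + h))) * exp (- s * of_real y) - of_real (frac (exp y)) * exp (- s * of_real y)"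
      unfolding 1 by (rule left_diff_distrib)
    also have "\<dots> = exp (of_real h * s) * e s (y + h) - e s y"
      unfolding e_def 2[symmetric] by (simp only: mult_ac)
    finally show ?thesis unfolding s_def .
  qed
  have int: "integrable lborel (\<lambda>y. exp (of_real h * Complex \<sigma> t) * e (Complex \<sigma> t) (y + h) - e (Complex \<sigma> t) y)" for t
    using shift(1)[of "Complex \<sigma> t"] e[of "Complex \<sigma> t"] by simp
  have "integrable lborel (\<lambda>y. complex_of_real (frac_diff \<sigma> h y))"
    using int[of 0] unfolding split[symmetric] by simp
  then show "integrable lborel (frac_diff \<sigma> h)" by (simp only: complex_of_real_integrable_eq)
  define Z where "Z = (\<integral>y. e (Complex \<sigma> t) y \<partial>lborel)"
  have "zeta (Complex \<sigma> t) = - Complex \<sigma> t * Z"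
    unfolding Z_def e_def using \<sigma> by (intro zeta_Mellin) auto
  moreover have "fourier (frac_diff \<sigma> h) t = exp (of_real h * Complex \<sigma> t) * Z - Z"
    unfolding fourier_def split Z_def using shift[of "Complex \<sigma> t"] e[of "Complex \<sigma> t"] by simp
  moreover have "Complex \<sigma> t \<noteq> 0" using \<sigma> by (simp add: complex_eq_iff)
  moreover have "E * Z - Z = - (E - 1) * (- s * Z) / s" if "s \<noteq> 0" for E s
    using that by (simp add: field_simps)
  ultimately show "fourier (frac_diff \<sigma> h) t = - (exp (of_real h * Complex \<sigma> t) - 1) * zeta (Complex \<sigma> t) / Complex \<sigma> t"
    by (simp only: not_False_eq_True)
qed

text \<open>If no integer lies between \<open>x\<close> and \<open>x * a\<close>, the difference of fractional parts is
\<open>x * (a - 1)\<close>, which is small and less than \<open>1\<close>; otherwise the difference of the floors pays for the trivial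
bound \<open>1\<close>. The difference of floors is the useful form because its weighted integral can be computed by
translation.\<close>

lemma frac_shift_square_le:
  fixes x a :: real
  assumes "0 < x" "1 \<le> a" "a \<le> 2"
  shows "(frac (x * a) - frac x)\<^sup>2 \<le> (a - 1) * min (x\<^sup>2) x + (of_int \<lfloor>x * a\<rfloor> - of_int \<lfloor>x\<rfloor>)"
proof -
  define D where "D = frac (x * a) - frac x"
  have xa: "x \<le> x * a" using assms by simp
  have D1: "\<bar>D\<bar> \<le> 1"
    using frac_lt_1[of x] frac_lt_1[of "x * a"] frac_ge_0[of x] frac_ge_0[of "x * a"] unfolding D_def by linarith
  have nn: "0 \<le> (a - 1) * min (x\<^sup>2) x" using assms by simp
  show ?thesis
  proof (cases "\<lfloor>x * a\<rfloor> = \<lfloor>x\<rfloor>")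
    case True
    then have D: "D = x * (a - 1)" unfolding D_def frac_def by (simp add: algebra_simps)
    have D0: "0 \<le> D" unfolding D using assms by simp
    have "D\<^sup>2 \<le> D * 1" unfolding power2_eq_square using D0 D1 by (intro mult_left_mono) auto
    moreover have "D\<^sup>2 \<le> (a - 1) * x\<^sup>2"
    proof -
      have "D\<^sup>2 = ((a - 1) * x\<^sup>2) * (a - 1)" unfolding D by (simp add: power2_eq_square)
      also have "\<dots> \<le> ((a - 1) * x\<^sup>2) * 1" using assms by (intro mult_left_mono) auto
      finally show ?thesis by simp
    qed
    ultimately have "D\<^sup>2 \<le> (a - 1) * min (x\<^sup>2) x" unfolding min_def D by (auto simp: mult.commute)
    then show ?thesis using True unfolding D_def by simp
  next
    case False
    then have "\<lfloor>x\<rfloor> + 1 \<le> \<lfloor>x * a\<rfloor>" using floor_mono[OF xa] by linarith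
    then have "1 \<le> real_of_int \<lfloor>x * a\<rfloor> - real_of_int \<lfloor>x\<rfloor>" by linarith
    moreover have "D\<^sup>2 \<le> 1" using D1 by (simp add: abs_square_le_1)
    ultimately show ?thesis using nn unfolding D_def by linarith
  qed
qed

text \<open>In the variable \<open>y\<close> the floor part of the pointwise bound is
\<open>exp (2 * \<sigma> * h) * N (y + h) - N y\<close> with \<open>N y = \<lfloor>exp y\<rfloor> * exp (- 2 * \<sigma> * y)\<close>, and translation invariance gives it the
integral \<open>(exp (2 * \<sigma> * h) - 1) * (integral of N)\<close>, of order \<open>h\<close>. Integrability of \<open>N\<close> at \<open>+\<infinity>\<close> is exactly the
condition \<open>\<sigma> > 1/2\<close>.\<close>

lemma frac_diff_square_integral:
  assumes \<sigma>: "1 / 2 < \<sigma>" "\<sigma> < 1"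
  shows "\<exists>C\<ge>0. \<forall>h. 0 < h \<and> h \<le> 1 / 4 \<longrightarrow> integrable lborel (\<lambda>y. (frac_diff \<sigma> h y)\<^sup>2) \<and>
           (\<integral>y. (frac_diff \<sigma> h y)\<^sup>2 \<partial>lborel) \<le> C * h"
proof -
  define B where "B y = indicator {..0} y * exp ((2 - 2 * \<sigma>) * y) + indicator {0..} y * exp (- (2 * \<sigma> - 1) * y)" for y :: real
  have B: "integrable lborel B"
    unfolding B_def using \<sigma> by (intro integrable_two_sided_exp) auto
  define N where "N y = of_int \<lfloor>exp y\<rfloor> * exp (- (2 * \<sigma>) * y)" for y :: real
  have N0: "0 \<le> N y" for y unfolding N_def by simp
  have Nm: "N \<in> borel_measurable lborel"
  proof -
    have "(\<lambda>y::real. exp y) \<in> borel_measurable borel"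
      by (intro borel_measurable_continuous_onI continuous_intros)
    then have "(\<lambda>y::real. real_of_int \<lfloor>exp y\<rfloor>) \<in> borel_measurable borel"
      by (rule measurable_compose[OF _ borel_measurable_real_floor])
    then show ?thesis unfolding N_def by measurable
  qed
  have NB: "N y \<le> B y" for y
  proof (cases "y < 0")
    case True
    then have "\<lfloor>exp y\<rfloor> = 0" by (intro floor_unique) auto
    then show ?thesis unfolding N_def B_def by (simp add: indicator_def)
  next
    case False
    have "N y \<le> exp y * exp (- (2 * \<sigma>) * y)" unfolding N_def by (intro mult_right_mono) auto
    also have "\<dots> = exp (- (2 * \<sigma> - 1) * y)" by (simp add: algebra_simps flip: exp_add)
    finally show ?thesis using False unfolding B_def by (auto simp: indicator_def intro: order_trans)
  qed
  have N: "integrable lborel N"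
    by (rule Bochner_Integration.integrable_bound[OF B Nm]) (use N0 NB in \<open>auto intro!: AE_I2 intro: order_trans[OF _ abs_ge_self]\<close>)
  define b n where "b = (\<integral>y. B y \<partial>lborel)" and "n = (\<integral>y. N y \<partial>lborel)"
  have "0 \<le> b" "0 \<le> n" unfolding b_def n_def B_def N_def by (intro integral_nonneg_AE AE_I2; simp)+
  have "integrable lborel (\<lambda>y. (frac_diff \<sigma> h y)\<^sup>2) \<and> (\<integral>y. (frac_diff \<sigma> h y)\<^sup>2 \<partial>lborel) \<le> (2 * b + 4 * n) * h"
    if h: "0 < h" "h \<le> 1 / 4" for h
  proof -
    define u where "u y = (exp h - 1) * B y + (exp (2 * \<sigma> * h) * N (y + h) - N y)" for y
    have Nh: "integrable lborel (\<lambda>y. N (y + h))" "(\<integral>y. N (y + h) \<partial>lborel) = n"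
      using lborel_integrable_real_affine[OF N, of 1 h] lborel_integral_real_affine[of 1 N h]
      unfolding n_def by (simp_all add: add.commute)
    have u: "integrable lborel u" unfolding u_def using B N Nh by simp
    have le: "(frac_diff \<sigma> h y)\<^sup>2 \<le> u y" for y
    proof -
      define x where "x = exp y"
      have x: "0 < x" unfolding x_def by simp
      have a: "1 \<le> exp h" "exp h \<le> 2" using h exp_bound_half[of h] by auto
      define E where "E = exp (- (2 * \<sigma>) * y)"
      have E2: "(exp (- \<sigma> * y))\<^sup>2 = E" unfolding E_def by (simp flip: exp_double)
      have "(frac_diff \<sigma> h y)\<^sup>2 = (frac (x * exp h) - frac x)\<^sup>2 * E"
        unfolding frac_diff_def power_mult_distrib E2 x_def exp_add ..
      also have "\<dots> \<le> ((exp h - 1) * min (x\<^sup>2) x + (of_int \<lfloor>x * exp h\<rfloor> - of_int \<lfloor>x\<rfloor>)) * E"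
        using frac_shift_square_le[OF x a] by (rule mult_right_mono) (simp add: E_def)
      also have "\<dots> = (exp h - 1) * (min (x\<^sup>2) x * E) + (of_int \<lfloor>x * exp h\<rfloor> * E - of_int \<lfloor>x\<rfloor> * E)"
        by (simp add: algebra_simps)
      also have "\<dots> \<le> (exp h - 1) * B y + (of_int \<lfloor>x * exp h\<rfloor> * E - of_int \<lfloor>x\<rfloor> * E)"
      proof (intro add_right_mono mult_left_mono)
        have "x\<^sup>2 * E = exp ((2 - 2 * \<sigma>) * y)" "x * E = exp (- (2 * \<sigma> - 1) * y)"
          unfolding x_def E_def power2_eq_square by (simp_all add: algebra_simps flip: exp_add)
        moreover have "min (x\<^sup>2) x * E \<le> x\<^sup>2 * E" "min (x\<^sup>2) x * E \<le> x * E"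
          by (intro mult_right_mono; simp add: E_def)+
        ultimately show "min (x\<^sup>2) x * E \<le> B y"
          unfolding B_def by (cases "y \<le> 0") (auto simp: indicator_def intro: order_trans add_increasing2)
      qed (use a in auto)
      also have "of_int \<lfloor>x * exp h\<rfloor> * E - of_int \<lfloor>x\<rfloor> * E = exp (2 * \<sigma> * h) * N (y + h) - N y"
      proof -
        have "E = exp (2 * \<sigma> * h) * exp (- (2 * \<sigma>) * (y + h))"
          unfolding E_def exp_add[symmetric] by (rule arg_cong[of _ _ exp]) (simp add: algebra_simps)
        then have "exp (2 * \<sigma> * h) * N (y + h) = of_int \<lfloor>exp (y + h)\<rfloor> * E"
          unfolding N_def by (simp only: mult_ac)
        then show ?thesis unfolding N_def[of y] E_def[symmetric] x_def exp_add[symmetric] by simp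
      qed
      finally show ?thesis unfolding u_def .
    qed
    have m: "frac_diff \<sigma> h \<in> borel_measurable lborel"
      using \<sigma> by (intro borel_measurable_integrable fourier_frac_diff(1)) auto
    have int: "integrable lborel (\<lambda>y. (frac_diff \<sigma> h y)\<^sup>2)"
      by (rule Bochner_Integration.integrable_bound[OF u])
         (use m le in \<open>auto intro!: AE_I2 intro: order_trans[OF _ abs_ge_self]\<close>)
    have "(\<integral>y. (frac_diff \<sigma> h y)\<^sup>2 \<partial>lborel) \<le> (\<integral>y. u y \<partial>lborel)"
      using int u le by (rule integral_mono)
    also have "\<dots> = (exp h - 1) * b + (exp (2 * \<sigma> * h) - 1) * n"
      unfolding u_def b_def using B N Nh by (simp add: n_def algebra_simps)
    also have "\<dots> \<le> (2 * h) * b + (4 * h) * n"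
    proof (intro add_mono mult_right_mono)
      show "exp h - 1 \<le> 2 * h" using real_exp_bound_lemma[of h] h by simp
      have "\<sigma> * h \<le> 1 * (1 / 4)" using \<sigma> h by (intro mult_mono) auto
      then have "exp (2 * \<sigma> * h) \<le> 1 + 2 * (2 * \<sigma> * h)" using \<sigma> h by (intro real_exp_bound_lemma) auto
      also have "\<dots> \<le> 1 + 2 * (2 * 1 * h)" using \<sigma> h by (intro add_left_mono mult_left_mono mult_right_mono) auto
      finally show "exp (2 * \<sigma> * h) - 1 \<le> 4 * h" by simp
    qed fact+
    finally show ?thesis using int by (simp add: algebra_simps)
  qed
  then show ?thesis using \<open>0 \<le> b\<close> \<open>0 \<le> n\<close> by (intro exI[of _ "2 * b + 4 * n"]) auto
qed

text \<open>The step \<open>h = 1 / (8 T)\<close> makes \<open>|h s| \<le> 1/4\<close> for \<open>s = \<sigma> + i t\<close> with \<open>0 \<le> t \<le> T\<close>, so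
\<open>|exp (h s) - 1| \<ge> |h s| / 2\<close> and \<open>|zeta s|\<close> is at most \<open>2 / h\<close> times the Fourier transform of \<open>frac_diff \<sigma> h\<close>. The mean
square of the latter is of order \<open>h\<close>, which leaves \<open>1 / h\<close>.\<close>

lemma zeta_mean_square:
  assumes \<sigma>: "1 / 2 < \<sigma>" "\<sigma> < 1"
  shows "\<exists>C. \<forall>T\<ge>1. (LINT t:{0..T}|lebesgue. (norm (zeta (Complex \<sigma> t)))\<^sup>2) \<le> C * T"
proof -
  obtain C where C: "0 \<le> C" "\<And>h. 0 < h \<Longrightarrow> h \<le> 1 / 4 \<Longrightarrow> integrable lborel (\<lambda>y. (frac_diff \<sigma> h y)\<^sup>2) \<and>
           (\<integral>y. (frac_diff \<sigma> h y)\<^sup>2 \<partial>lborel) \<le> C * h"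
    using frac_diff_square_integral[OF \<sigma>] by blast
  have cont: "continuous_on UNIV (\<lambda>t. zeta (Complex \<sigma> t))"
    using \<sigma> by (intro continuous_zeta_vertical) auto
  have "(LINT t:{0..T}|lebesgue. (norm (zeta (Complex \<sigma> t)))\<^sup>2) \<le> (64 * pi * exp (1 / 2) * C) * T" if T: "1 \<le> T" for T
  proof -
    define h where "h = 1 / (8 * T)"
    have h: "0 < h" "h \<le> 1 / 4" using T unfolding h_def by (auto simp: field_simps)
    define \<phi> where "\<phi> t = fourier (frac_diff \<sigma> h) t" for t
    have \<phi>_eq: "\<phi> t = - (exp (of_real h * Complex \<sigma> t) - 1) * zeta (Complex \<sigma> t) / Complex \<sigma> t" for t
      unfolding \<phi>_def using \<sigma> by (intro fourier_frac_diff(2)) auto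
    have ne: "Complex \<sigma> t \<noteq> 0" for t using \<sigma> by (simp add: complex_eq_iff)
    have "continuous_on UNIV \<phi>"
    proof -
      have "continuous_on UNIV (\<lambda>t. Complex \<sigma> t)" by (simp add: Complex_eq) (intro continuous_intros)
      then show ?thesis unfolding \<phi>_eq using ne by (intro continuous_intros cont) auto
    qed
    then have int\<phi>: "set_integrable lborel {- T..T} (\<lambda>t. (norm (\<phi> t))\<^sup>2)"
      by (intro borel_integrable_atLeastAtMost' continuous_intros) (auto elim: continuous_on_subset)
    have intz: "set_integrable lborel {0..T} (\<lambda>t. (norm (zeta (Complex \<sigma> t)))\<^sup>2)"
      using cont by (intro borel_integrable_atLeastAtMost' continuous_intros) (auto elim: continuous_on_subset)
    have le: "(norm (zeta (Complex \<sigma> t)))\<^sup>2 \<le> (4 / h\<^sup>2) * (norm (\<phi> t))\<^sup>2" if t: "0 \<le> t" "t \<le> T" for t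
    proof -
      define s where "s = Complex \<sigma> t"
      have "norm s \<le> \<bar>Re s\<bar> + \<bar>Im s\<bar>" by (rule cmod_le)
      also have "\<dots> \<le> 2 * T" using t T \<sigma> unfolding s_def by simp
      finally have "norm (of_real h * s) \<le> h * (2 * T)" using h by (simp add: norm_mult)
      also have "\<dots> = 1 / 4" using T unfolding h_def by simp
      finally have "norm (of_real h * s) / 2 \<le> norm (exp (of_real h * s) - 1)" by (rule norm_exp_minus_one_ge)
      then have "h * norm s / 2 \<le> norm (exp (of_real h * s) - 1)" using h by (simp add: norm_mult)
      then have "h * norm s / 2 * (norm (zeta s) / norm s) \<le> norm (exp (of_real h * s) - 1) * (norm (zeta s) / norm s)"
        by (rule mult_right_mono) simp
      also have "\<dots> = norm (\<phi> t)" unfolding \<phi>_eq s_def[symmetric] by (simp add: norm_mult norm_divide norm_minus_commute)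
      finally have "norm (zeta s) \<le> (2 / h) * norm (\<phi> t)"
        using h ne[of t] unfolding s_def[symmetric] by (simp add: field_simps)
      then have "(norm (zeta s))\<^sup>2 \<le> ((2 / h) * norm (\<phi> t))\<^sup>2" by (rule power_mono) simp
      then show ?thesis unfolding s_def power_mult_distrib by (simp add: power_divide)
    qed
    have "(LINT t:{0..T}|lebesgue. (norm (zeta (Complex \<sigma> t)))\<^sup>2) = (LINT t:{0..T}|lborel. (norm (zeta (Complex \<sigma> t)))\<^sup>2)"
      using borel_measurable_integrable[OF intz[unfolded set_integrable_def]]
      unfolding set_lebesgue_integral_def by (intro integral_completion) simp
    also have "\<dots> \<le> (LINT t:{- T..T}|lborel. (4 / h\<^sup>2) * (norm (\<phi> t))\<^sup>2)"
      unfolding set_lebesgue_integral_def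
    proof (rule integral_mono)
      show "integrable lborel (\<lambda>t. indicat_real {0..T} t *\<^sub>R (norm (zeta (Complex \<sigma> t)))\<^sup>2)"
        using intz unfolding set_integrable_def .
      show "integrable lborel (\<lambda>t. indicat_real {- T..T} t *\<^sub>R (4 / h\<^sup>2 * (norm (\<phi> t))\<^sup>2))"
        using set_integrable_mult_right[OF int\<phi>, of "4 / h\<^sup>2"] unfolding set_integrable_def .
      show "indicat_real {0..T} t *\<^sub>R (norm (zeta (Complex \<sigma> t)))\<^sup>2 \<le> indicat_real {- T..T} t *\<^sub>R (4 / h\<^sup>2 * (norm (\<phi> t))\<^sup>2)" for t
        using le[of t] T by (auto simp: indicator_def)
    qed
    also have "\<dots> = (4 / h\<^sup>2) * (LINT t:{- T..T}|lborel. (norm (\<phi> t))\<^sup>2)" by (rule set_integral_mult_right)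
    also have "\<dots> \<le> (4 / h\<^sup>2) * (2 * pi * exp (1 / 2) * (\<integral>y. (frac_diff \<sigma> h y)\<^sup>2 \<partial>lborel))"
      unfolding \<phi>_def using C(2)[OF h] T \<sigma>
      by (intro mult_left_mono fourier_mean_square fourier_frac_diff(1)) auto
    also have "\<dots> \<le> (4 / h\<^sup>2) * (2 * pi * exp (1 / 2) * (C * h))"
      using C(2)[OF h] by (intro mult_left_mono) auto
    also have "\<dots> = (64 * pi * exp (1 / 2) * C) * T"
      using T unfolding h_def by (simp add: field_simps power2_eq_square)
    finally show ?thesis .
  qed
  then show ?thesis by blast
qed

section \<open>Moments of zeta on different vertical lines\<close>

text \<open>The \<open>k\<close>-th power of \<open>zeta s * (s - 1) / (s + 1)\<close>. On a vertical line in the right half-plane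
other than \<open>Re s = 1\<close> its modulus is comparable to that of \<open>zeta s ^ k\<close>, because the factor lies between positive constants there.\<close>

definition zeta_power_reg :: "nat \<Rightarrow> complex \<Rightarrow> complex" where
  "zeta_power_reg k s = (zeta_num s / (s + 1)) ^ k"

lemma zeta_power_reg_holomorphic: "zeta_power_reg k holomorphic_on {s. 0 < Re s}"
  unfolding zeta_power_reg_def
  by (intro holomorphic_intros zeta_num_holomorphic) (auto simp: complex_eq_iff)

lemma norm_minus_one_le_plus_one: "0 \<le> Re s \<Longrightarrow> norm (s - 1) \<le> norm (s + 1)"
  unfolding cmod_def by (intro real_sqrt_le_mono add_mono abs_le_square_iff[THEN iffD1]) auto

lemma norm_plus_one_le_minus_one:
  assumes "0 \<le> Re s"
  shows "\<bar>Re s - 1\<bar> * norm (s + 1) \<le> (Re s + 1) * norm (s - 1)"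
proof (rule power2_le_imp_le)
  have "(Re s - 1)\<^sup>2 * (Im s)\<^sup>2 \<le> (Re s + 1)\<^sup>2 * (Im s)\<^sup>2"
    using assms by (intro mult_right_mono abs_le_square_iff[THEN iffD1]) auto
  then show "(\<bar>Re s - 1\<bar> * norm (s + 1))\<^sup>2 \<le> ((Re s + 1) * norm (s - 1))\<^sup>2"
    unfolding power_mult_distrib cmod_power2 by (simp add: algebra_simps)
qed (use assms in auto)

lemma norm_zeta_power_reg:
  assumes "0 < Re s" "s \<noteq> 1"
  shows "norm (zeta_power_reg k s) \<le> norm (zeta s) ^ k"
    and "(\<bar>Re s - 1\<bar> / (Re s + 1)) ^ k * norm (zeta s) ^ k \<le> norm (zeta_power_reg k s)"
proof -
  have s1: "s + 1 \<noteq> 0" using assms by (auto simp: complex_eq_iff)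
  have eq: "norm (zeta_power_reg k s) = (norm (s - 1) / norm (s + 1)) ^ k * norm (zeta s) ^ k"
    unfolding zeta_power_reg_def using assms
    by (simp add: zeta_eq_zeta_num norm_power norm_divide norm_mult power_divide)
  have "(norm (s - 1) / norm (s + 1)) ^ k \<le> 1 ^ k"
    using norm_minus_one_le_plus_one[of s] assms s1 by (intro power_mono) (auto simp: divide_le_eq)
  then show "norm (zeta_power_reg k s) \<le> norm (zeta s) ^ k"
    unfolding eq by (intro mult_left_le_one_le) auto
  have "(\<bar>Re s - 1\<bar> / (Re s + 1)) ^ k \<le> (norm (s - 1) / norm (s + 1)) ^ k"
    using norm_plus_one_le_minus_one[of s] assms s1
    by (intro power_mono) (auto simp: field_simps)
  then show "(\<bar>Re s - 1\<bar> / (Re s + 1)) ^ k * norm (zeta s) ^ k \<le> norm (zeta_power_reg k s)"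
    unfolding eq by (rule mult_right_mono) simp
qed

lemma zeta_power_reg_growth:
  "\<exists>P\<ge>0. \<forall>s. 1 / 2 < Re s \<and> Re s \<le> 5 \<longrightarrow> norm (zeta_power_reg k s) \<le> P * (1 + \<bar>Im s\<bar>) ^ k"
proof -
  obtain C where C: "0 \<le> C" "\<And>s. 1 / 2 \<le> Re s \<Longrightarrow> norm (zeta_num s) \<le> norm s * (1 + C * norm (s - 1))"
    using zeta_num_growth by blast
  have "norm (zeta_power_reg k s) \<le> (1 + 6 * C) ^ k * (1 + \<bar>Im s\<bar>) ^ k" if s: "1 / 2 < Re s" "Re s \<le> 5" for s
  proof -
    have s1: "s + 1 \<noteq> 0" using s by (auto simp: complex_eq_iff)
    have "norm (zeta_num s) \<le> norm s * (1 + C * norm (s - 1))" using C(2) s by simp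
    also have "\<dots> \<le> norm (s + 1) * ((1 + 6 * C) * (1 + \<bar>Im s\<bar>))"
    proof (rule mult_mono)
      show "norm s \<le> norm (s + 1)"
        unfolding cmod_def using s by (intro real_sqrt_le_mono add_mono abs_le_square_iff[THEN iffD1]) auto
      have "norm (s - 1) \<le> \<bar>Re (s - 1)\<bar> + \<bar>Im (s - 1)\<bar>" by (rule cmod_le)
      also have "\<dots> \<le> 6 * (1 + \<bar>Im s\<bar>)" using s by simp
      finally have "C * norm (s - 1) \<le> C * (6 * (1 + \<bar>Im s\<bar>))" using C(1) by (rule mult_left_mono)
      then show "1 + C * norm (s - 1) \<le> (1 + 6 * C) * (1 + \<bar>Im s\<bar>)" by (simp add: algebra_simps)
    qed (use C in auto)
    finally have "norm (zeta_num s / (s + 1)) \<le> (1 + 6 * C) * (1 + \<bar>Im s\<bar>)"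
      using s1 by (simp add: norm_divide divide_le_eq mult.commute)
    then show ?thesis
      unfolding zeta_power_reg_def norm_power power_mult_distrib[symmetric] by (rule power_mono) simp
  qed
  then show ?thesis using C(1) by (intro exI[of _ "(1 + 6 * C) ^ k"]) auto
qed

lemma zeta_power_reg_bounded:
  "\<exists>B>0. \<forall>s. Re s = 4 \<longrightarrow> norm (zeta_power_reg k s) \<le> B"
proof -
  define B where "B = (\<Sum>n. real (Suc n) powr (- 4))"
  have "norm (zeta_power_reg k s) \<le> (1 + B) ^ k" if s: "Re s = 4" for s
  proof -
    have "norm (zeta_power_reg k s) \<le> norm (zeta s) ^ k"
      using s by (intro norm_zeta_power_reg) auto
    also have "\<dots> \<le> (1 + B) ^ k"
      using norm_zeta_le_real_series(1)[of s] s unfolding B_def by (intro power_mono) auto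
    finally show ?thesis .
  qed
  moreover have "0 \<le> B" unfolding B_def
    using norm_zeta_le_real_series(2)[of 4] by (intro suminf_nonneg) auto
  ultimately show ?thesis by (intro exI[of _ "(1 + B) ^ k"]) auto
qed

lemma zeta_power_reg_lower:
  assumes "Re s = 3"
  shows "(1 / 4) ^ k \<le> norm (zeta_power_reg k s)"
proof -
  have "(1 / 4) ^ k \<le> (1 / 2 * norm (zeta s)) ^ k"
    using norm_zeta_ge_half[of s] assms by (intro power_mono) auto
  also have "\<dots> \<le> norm (zeta_power_reg k s)"
    unfolding power_mult_distrib using norm_zeta_power_reg(2)[of s k] assms by (auto simp: complex_eq_iff)
  finally show ?thesis .
qed

lemma shifted_integral_le:
  fixes G :: "real \<Rightarrow> real"
  assumes cont: "continuous_on UNIV G" and nn: "\<And>t. 0 \<le> G t" and even: "\<And>t. G (- t) = G t" and T: "0 \<le> T"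
  shows "(LINT u:{0..T}|lebesgue. G (u + v)) \<le> 2 * (LINT u:{0..T + \<bar>v\<bar>}|lebesgue. G u)"
proof -
  define R where "R = T + \<bar>v\<bar>"
  have cont': "continuous_on UNIV (\<lambda>u. G (u + v))"
    by (intro continuous_on_compose2[OF cont] continuous_intros) auto
  have hk: "(LINT u:{a..b}|lebesgue. g u) = integral {a..b} g" if "continuous_on UNIV g" for a b and g :: "real \<Rightarrow> real"
    using that by (intro set_lebesgue_integral_eq_integral set_integrable_lebesgue_continuous[where a = a and b = b]) auto
  have on: "G integrable_on {a..b}" for a b
    by (intro integrable_continuous_real continuous_on_subset[OF cont]) auto
  have "integral {0..T} (\<lambda>u. G (u + v)) = integral {v..T + v} G"
    using integral_shift[where a = 0 and b = T and c = v and f = G] continuous_on_subset[OF cont] by (simp add: o_def)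
  also have "\<dots> \<le> integral {- R..R} G"
    unfolding R_def using T nn by (intro integral_subset_le on) auto
  also have "\<dots> = integral {- R..0} G + integral {0..R} G"
    unfolding R_def using T on by (intro Henstock_Kurzweil_Integration.integral_combine[symmetric]) auto
  also have "integral {- R..0} G = integral {0..R} G"
    using Henstock_Kurzweil_Integration.integral_reflect_real[where f = G and a = 0 and b = R] even by simp
  finally show ?thesis
    unfolding hk[OF cont] hk[OF cont'] R_def by simp
qed

lemma one_plus_abs_le_exp: "1 + \<bar>v\<bar> \<le> 2 * exp (v\<^sup>2)" for v :: real
proof -
  have "0 \<le> (\<bar>v\<bar> - 1)\<^sup>2" by simp
  then have "\<bar>v\<bar> \<le> 1 + v\<^sup>2" by (simp add: power2_diff) 
  then show ?thesis using exp_ge_add_one_self[of "v\<^sup>2"] by (smt (verit) zero_le_power2)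
qed

lemma continuous_zeta_vertical_power:
  assumes "0 < \<sigma>" "\<sigma> < 1"
  shows "continuous_on UNIV (\<lambda>t. norm (zeta (Complex \<sigma> t)) ^ n)"
  using assms by (intro continuous_intros continuous_zeta_vertical) auto

lemma set_integrable_zeta_power:
  assumes "0 < \<sigma>" "\<sigma> < 1" "S \<in> sets lebesgue" "S \<subseteq> {0..T}"
  shows "set_integrable lebesgue S (\<lambda>t. norm (zeta (Complex \<sigma> t)) ^ n)"
  using assms by (intro set_integrable_lebesgue_continuous[OF continuous_zeta_vertical_power]) auto

lemma continuous_zeta_power_reg:
  assumes "0 < x"
  shows "continuous_on UNIV (\<lambda>u. zeta_power_reg k (Complex x u))"
proof -
  have "continuous_on UNIV (\<lambda>u. zeta_power_reg k (of_real x + \<i> * of_real u))"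
    using assms
    by (intro continuous_on_compose2[OF holomorphic_on_imp_continuous_on[OF zeta_power_reg_holomorphic]] continuous_intros) auto
  then show ?thesis by (simp add: Complex_eq)
qed

lemma zeta_moment_mono:
  assumes "0 < \<sigma>" "\<sigma> < 1" "T \<le> T'"
  shows "zeta_moment k \<sigma> T \<le> zeta_moment k \<sigma> T'"
  unfolding zeta_moment_def set_lebesgue_integral_def
  by (intro integral_mono set_integrable_zeta_power[OF assms(1,2), unfolded set_integrable_def, of _ T']
      set_integrable_zeta_power[OF assms(1,2), unfolded set_integrable_def, of _ T])
     (use assms(3) in \<open>auto simp: indicator_def\<close>)

lemma zeta_moment_nonneg: "0 \<le> zeta_moment k \<sigma> T"
  unfolding zeta_moment_def set_lebesgue_integral_def by (intro integral_nonneg_AE) auto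

lemma zeta_moment_bigo_iff:
  assumes \<sigma>: "0 < \<sigma>" "\<sigma> < 1"
  shows "zeta_moment k \<sigma> \<in> O[at_top](\<lambda>T. T) \<longleftrightarrow> (\<exists>C\<ge>0. \<forall>T\<ge>1. zeta_moment k \<sigma> T \<le> C * T)"
proof
  assume "zeta_moment k \<sigma> \<in> O[at_top](\<lambda>T. T)"
  then obtain c where c: "0 < c" "\<forall>\<^sub>F T in at_top. norm (zeta_moment k \<sigma> T) \<le> c * norm T"
    by (elim landau_o.bigE)
  then obtain X where X: "\<And>T. X \<le> T \<Longrightarrow> norm (zeta_moment k \<sigma> T) \<le> c * norm T"
    by (auto simp: eventually_at_top_linorder)
  define Y where "Y = max X 1"
  have "zeta_moment k \<sigma> T \<le> (c * Y) * T" if T: "1 \<le> T" for T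
  proof -
    have "zeta_moment k \<sigma> T \<le> zeta_moment k \<sigma> (max Y T)" by (intro zeta_moment_mono \<sigma>) auto
    also have "\<dots> \<le> c * max Y T" using X[of "max Y T"] T by (auto simp: Y_def abs_le_iff le_max_iff_disj)
    also have "max Y T \<le> Y * T"
    proof -
      have "Y * 1 \<le> Y * T" "1 * T \<le> Y * T" using T unfolding Y_def by (intro mult_left_mono mult_right_mono; simp)+
      then show ?thesis by simp
    qed
    finally show ?thesis using c by simp
  qed
  then show "\<exists>C\<ge>0. \<forall>T\<ge>1. zeta_moment k \<sigma> T \<le> C * T"
    using c by (intro exI[of _ "c * Y"]) (auto simp: Y_def)
next
  assume "\<exists>C\<ge>0. \<forall>T\<ge>1. zeta_moment k \<sigma> T \<le> C * T"
  then obtain C where C: "\<And>T. 1 \<le> T \<Longrightarrow> zeta_moment k \<sigma> T \<le> C * T" by blast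
  show "zeta_moment k \<sigma> \<in> O[at_top](\<lambda>T. T)"
  proof (rule landau_o.bigI[of "\<bar>C\<bar> + 1"])
    show "\<forall>\<^sub>F T in at_top. norm (zeta_moment k \<sigma> T) \<le> (\<bar>C\<bar> + 1) * norm T"
      using eventually_ge_at_top[of 1]
    proof eventually_elim
      case (elim T)
      have "zeta_moment k \<sigma> T \<le> C * T" using C elim .
      also have "\<dots> \<le> (\<bar>C\<bar> + 1) * T" using elim by (intro mult_right_mono) auto
      finally show ?case using elim zeta_moment_nonneg[of k \<sigma> T] by simp
    qed
  qed simp
qed

lemma norm_zeta_power_square: "(norm (zeta s) ^ k)\<^sup>2 = norm (zeta s) ^ (2 * k)"
  by (simp only: power_mult[symmetric] mult.commute[of 2])

lemma shifted_zeta_moment_le: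
  assumes \<sigma>: "0 < \<sigma>" "\<sigma> < 1" and T: "0 \<le> T"
  shows "(LINT u:{0..T}|lebesgue. (norm (zeta_power_reg k (Complex \<sigma> (u + v))))\<^sup>2)
           \<le> 2 * zeta_moment k \<sigma> (T + \<bar>v\<bar>)"
proof -
  define G where "G t = norm (zeta (Complex \<sigma> t)) ^ (2 * k)" for t
  have contG: "continuous_on UNIV G" unfolding G_def by (rule continuous_zeta_vertical_power[OF \<sigma>])
  have "G (- t) = G t" for t
  proof -
    have "Complex \<sigma> (- t) = cnj (Complex \<sigma> t)" by (simp add: complex_eq_iff)
    moreover have "norm (zeta (cnj (Complex \<sigma> t))) = norm (zeta (Complex \<sigma> t))"
      using \<sigma> by (intro norm_zeta_cnj) (auto simp: complex_eq_iff)
    ultimately show ?thesis unfolding G_def by (simp only:)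
  qed
  then have "(LINT u:{0..T}|lebesgue. G (u + v)) \<le> 2 * (LINT u:{0..T + \<bar>v\<bar>}|lebesgue. G u)"
    using contG T by (intro shifted_integral_le) (auto simp: G_def)
  moreover have "(LINT u:{0..T}|lebesgue. (norm (zeta_power_reg k (Complex \<sigma> (u + v))))\<^sup>2) \<le> (LINT u:{0..T}|lebesgue. G (u + v))"
    unfolding set_lebesgue_integral_def
  proof (rule integral_mono)
    show "integrable lebesgue (\<lambda>u. indicat_real {0..T} u *\<^sub>R (norm (zeta_power_reg k (Complex \<sigma> (u + v))))\<^sup>2)"
      using set_integrable_lebesgue_continuous[where a = 0 and b = T and S = "{0..T}" and g = "\<lambda>u. (norm (zeta_power_reg k (Complex \<sigma> (u + v))))\<^sup>2"]
        continuous_on_compose2[OF continuous_zeta_power_reg[of \<sigma> k], of UNIV "\<lambda>u. u + v"] \<sigma>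
      unfolding set_integrable_def by (simp add: continuous_intros)
    show "integrable lebesgue (\<lambda>u. indicat_real {0..T} u *\<^sub>R G (u + v))"
      using set_integrable_lebesgue_continuous[where a = 0 and b = T and S = "{0..T}" and g = "\<lambda>u. G (u + v)"]
        continuous_on_compose2[OF contG, of UNIV "\<lambda>u. u + v"]
      unfolding set_integrable_def by (simp add: continuous_intros)
    fix u
    have "norm (zeta_power_reg k (Complex \<sigma> (u + v))) \<le> norm (zeta (Complex \<sigma> (u + v))) ^ k"
      using \<sigma> by (intro norm_zeta_power_reg) (auto simp: complex_eq_iff)
    then have "(norm (zeta_power_reg k (Complex \<sigma> (u + v))))\<^sup>2 \<le> G (u + v)"
      unfolding G_def norm_zeta_power_square[symmetric] by (rule power_mono) simp
    then show "indicat_real {0..T} u *\<^sub>R (norm (zeta_power_reg k (Complex \<sigma> (u + v))))\<^sup>2 \<le> indicat_real {0..T} u *\<^sub>R G (u + v)"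
      by (simp add: indicator_def)
  qed
  ultimately show ?thesis unfolding zeta_moment_def G_def by simp
qed

text \<open>The size of \<open>J\<close> is left open: the upper bounds for the moments use a multiple of \<open>T\<close>,
while the lower bound needs a \<open>J\<close> expressed through the moment on the line \<open>Re s = a\<close> itself.\<close>

lemma zeta_power_reg_mean_square_le:
  assumes a: "1 / 2 < a" "a < c" "c < 4"
  shows "\<exists>K>0. \<forall>S T J m. S \<in> sets lebesgue \<longrightarrow> S \<subseteq> {0..T} \<longrightarrow> 0 \<le> T \<longrightarrow> 0 < J \<longrightarrow>
      (\<forall>v. exp (- 2 * v\<^sup>2) * (LINT u:{0..T}|lebesgue. (norm (zeta_power_reg k (Complex a (u + v))))\<^sup>2) \<le> J) \<longrightarrow>
      measure lebesgue S \<le> m \<longrightarrow> 0 < m \<longrightarrow>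
      (LINT u:S|lebesgue. (norm (zeta_power_reg k (Complex c u)))\<^sup>2)
        \<le> K * J powr ((4 - c) / (4 - a)) * m powr ((c - a) / (4 - a))"
proof -
  obtain P where P: "0 \<le> P" "\<And>s. 1 / 2 < Re s \<Longrightarrow> Re s \<le> 5 \<Longrightarrow> norm (zeta_power_reg k s) \<le> P * (1 + \<bar>Im s\<bar>) ^ k"
    using zeta_power_reg_growth by blast
  obtain B where B: "0 < B" "\<And>s. Re s = 4 \<Longrightarrow> norm (zeta_power_reg k s) \<le> B"
    using zeta_power_reg_bounded by blast
  define K where "K = exp (2 * (4 - a)\<^sup>2) * (B\<^sup>2) powr ((c - a) / (4 - a))"
  have "(LINT u:S|lebesgue. (norm (zeta_power_reg k (Complex c u)))\<^sup>2)
        \<le> K * J powr ((4 - c) / (4 - a)) * m powr ((c - a) / (4 - a))"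
    if S: "S \<in> sets lebesgue" "S \<subseteq> {0..T}" and T: "0 \<le> T" and J: "0 < J"
      "\<forall>v. exp (- 2 * v\<^sup>2) * (LINT u:{0..T}|lebesgue. (norm (zeta_power_reg k (Complex a (u + v))))\<^sup>2) \<le> J"
      and m: "measure lebesgue S \<le> m" "0 < m" for S T J m
  proof -
    have "(LINT u:S|lebesgue. (norm (zeta_power_reg k (Complex c u)))\<^sup>2)
        \<le> exp (2 * (4 - a)\<^sup>2) * J powr ((4 - c) / (4 - a)) * (B\<^sup>2 * m) powr ((c - a) / (4 - a))"
    proof (rule shifted_mean_square_bound[where ?a0.0 = "1 / 2" and P = P and N = k and T = T])
      show "zeta_power_reg k holomorphic_on {z. 1 / 2 < Re z}"
        by (rule holomorphic_on_subset[OF zeta_power_reg_holomorphic]) auto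
    qed (use a P B S T J m in auto)
    then show ?thesis unfolding K_def using B m by (simp add: powr_mult mult_ac)
  qed
  moreover have "0 < K" unfolding K_def using B by simp
  ultimately show ?thesis by blast
qed

text \<open>Over the interval shifted by \<open>v\<close> the moment is at most of order \<open>T + |v|\<close>, and half of
the Gaussian weight absorbs \<open>1 + |v|\<close>. The other half remains and makes large shifts negligible in the lower bound
for the moments.\<close>

lemma shifted_zeta_moment_gaussian_le:
  assumes \<sigma>: "0 < \<sigma>" "\<sigma> < 1" and C: "0 \<le> C" "\<And>T. 1 \<le> T \<Longrightarrow> zeta_moment k \<sigma> T \<le> C * T" and T: "1 \<le> T"
  shows "exp (- 2 * v\<^sup>2) * (LINT u:{0..T}|lebesgue. (norm (zeta_power_reg k (Complex \<sigma> (u + v))))\<^sup>2)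
           \<le> 4 * C * T * exp (- v\<^sup>2)"
proof -
  have "(LINT u:{0..T}|lebesgue. (norm (zeta_power_reg k (Complex \<sigma> (u + v))))\<^sup>2) \<le> 2 * zeta_moment k \<sigma> (T + \<bar>v\<bar>)"
    using \<sigma> T by (intro shifted_zeta_moment_le) auto
  also have "\<dots> \<le> 2 * (C * (T + \<bar>v\<bar>))" using C(2)[of "T + \<bar>v\<bar>"] T by simp
  also have "\<dots> \<le> 2 * (C * (T * (2 * exp (v\<^sup>2))))"
  proof (intro mult_left_mono C)
    have "T + \<bar>v\<bar> \<le> T * (1 + \<bar>v\<bar>)" using T mult_right_mono[of 1 T "\<bar>v\<bar>"] by (simp add: algebra_simps)
    also have "\<dots> \<le> T * (2 * exp (v\<^sup>2))" using T one_plus_abs_le_exp by (intro mult_left_mono) auto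
    finally show "T + \<bar>v\<bar> \<le> T * (2 * exp (v\<^sup>2))" .
  qed simp
  finally have "exp (- 2 * v\<^sup>2) * (LINT u:{0..T}|lebesgue. (norm (zeta_power_reg k (Complex \<sigma> (u + v))))\<^sup>2)
      \<le> exp (- 2 * v\<^sup>2) * (2 * (C * (T * (2 * exp (v\<^sup>2)))))"
    by (rule mult_left_mono) simp
  also have "\<dots> = 4 * C * T * (exp (- 2 * v\<^sup>2) * exp (v\<^sup>2))" by simp
  also have "exp (- 2 * v\<^sup>2) * exp (v\<^sup>2) = exp (- v\<^sup>2)" by (simp flip: exp_add)
  finally show ?thesis .
qed

text \<open>The exponent of the measure \<open>m\<close> is positive, so this is a quantitative form of uniform
integrability; for \<open>m = T\<close> it is the convexity of the moments in \<open>\<sigma>\<close>.\<close>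

lemma zeta_power_integral_on_set_le:
  assumes a: "1 / 2 < a" "a < c" "c < 1" and M: "zeta_moment k a \<in> O[at_top](\<lambda>T. T)"
  obtains K \<theta> where "0 < K" "0 < \<theta>" "\<theta> < 1"
    "\<forall>T S m. 1 \<le> T \<longrightarrow> S \<in> sets lebesgue \<longrightarrow> S \<subseteq> {0..T} \<longrightarrow> measure lebesgue S \<le> m \<longrightarrow> 0 < m \<longrightarrow>
      (LINT u:S|lebesgue. norm (zeta (Complex c u)) ^ (2 * k)) \<le> K * T powr (1 - \<theta>) * m powr \<theta>"
proof -
  have a01: "0 < a" "a < 1" using a by auto
  obtain C where C: "0 \<le> C" "\<And>T. 1 \<le> T \<Longrightarrow> zeta_moment k a T \<le> C * T"
    using M zeta_moment_bigo_iff[OF a01] by blast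
  obtain K where K: "0 < K" and main: "\<And>S T J m. S \<in> sets lebesgue \<Longrightarrow> S \<subseteq> {0..T} \<Longrightarrow> 0 \<le> T \<Longrightarrow> 0 < J \<Longrightarrow>
      (\<And>v. exp (- 2 * v\<^sup>2) * (LINT u:{0..T}|lebesgue. (norm (zeta_power_reg k (Complex a (u + v))))\<^sup>2) \<le> J) \<Longrightarrow>
      measure lebesgue S \<le> m \<Longrightarrow> 0 < m \<Longrightarrow>
      (LINT u:S|lebesgue. (norm (zeta_power_reg k (Complex c u)))\<^sup>2)
        \<le> K * J powr ((4 - c) / (4 - a)) * m powr ((c - a) / (4 - a))"
    using zeta_power_reg_mean_square_le[of a c k] a by auto
  define \<theta> where "\<theta> = (c - a) / (4 - a)"
  have \<theta>: "0 < \<theta>" "\<theta> < 1" "(4 - c) / (4 - a) = 1 - \<theta>"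
    unfolding \<theta>_def using a by (auto simp: field_simps)
  define q where "q = (((1 - c) / (c + 1)) ^ k)\<^sup>2"
  have q: "0 < q" unfolding q_def using a by simp
  define K' where "K' = K * (4 * (C + 1)) powr (1 - \<theta>) / q"
  have "(LINT u:S|lebesgue. norm (zeta (Complex c u)) ^ (2 * k)) \<le> K' * T powr (1 - \<theta>) * m powr \<theta>"
    if T: "1 \<le> T" and S: "S \<in> sets lebesgue" "S \<subseteq> {0..T}" and m: "measure lebesgue S \<le> m" "0 < m" for T S m
  proof -
    define J where "J = 4 * (C + 1) * T"
    have "(LINT u:S|lebesgue. (norm (zeta_power_reg k (Complex c u)))\<^sup>2)
        \<le> K * J powr ((4 - c) / (4 - a)) * m powr ((c - a) / (4 - a))"
    proof (rule main[OF S])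
      show "0 < J" unfolding J_def using C T by simp
      fix v
      have "exp (- 2 * v\<^sup>2) * (LINT u:{0..T}|lebesgue. (norm (zeta_power_reg k (Complex a (u + v))))\<^sup>2) \<le> 4 * C * T * exp (- v\<^sup>2)"
        by (rule shifted_zeta_moment_gaussian_le[OF a01 C T])
      also have "\<dots> \<le> 4 * (C + 1) * T * 1" using C T by (intro mult_mono) auto
      finally show "exp (- 2 * v\<^sup>2) * (LINT u:{0..T}|lebesgue. (norm (zeta_power_reg k (Complex a (u + v))))\<^sup>2) \<le> J"
        unfolding J_def by simp
    qed (use T m in auto)
    also have "\<dots> = q * (K' * T powr (1 - \<theta>) * m powr \<theta>)"
      unfolding \<theta>(3) \<theta>_def[symmetric] J_def K'_def using q T C by (simp add: powr_mult)
    finally have 1: "(LINT u:S|lebesgue. (norm (zeta_power_reg k (Complex c u)))\<^sup>2) \<le> q * (K' * T powr (1 - \<theta>) * m powr \<theta>)" .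
    have "q * (LINT u:S|lebesgue. norm (zeta (Complex c u)) ^ (2 * k)) = (LINT u:S|lebesgue. q * norm (zeta (Complex c u)) ^ (2 * k))"
      by (rule set_integral_mult_right[symmetric])
    also have "\<dots> \<le> (LINT u:S|lebesgue. (norm (zeta_power_reg k (Complex c u)))\<^sup>2)"
    proof (rule set_integral_mono)
      show "set_integrable lebesgue S (\<lambda>u. q * norm (zeta (Complex c u)) ^ (2 * k))"
        using a S by (intro set_integrable_mult_right set_integrable_zeta_power) auto
      show "set_integrable lebesgue S (\<lambda>u. (norm (zeta_power_reg k (Complex c u)))\<^sup>2)"
        using a by (intro set_integrable_lebesgue_continuous[OF _ S] continuous_intros continuous_zeta_power_reg) auto
      fix u
      have "((1 - c) / (c + 1)) ^ k * norm (zeta (Complex c u)) ^ k \<le> norm (zeta_power_reg k (Complex c u))"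
        using norm_zeta_power_reg(2)[of "Complex c u" k] a by (auto simp: complex_eq_iff)
      then have "(((1 - c) / (c + 1)) ^ k * norm (zeta (Complex c u)) ^ k)\<^sup>2 \<le> (norm (zeta_power_reg k (Complex c u)))\<^sup>2"
        using a by (intro power_mono) auto
      then show "q * norm (zeta (Complex c u)) ^ (2 * k) \<le> (norm (zeta_power_reg k (Complex c u)))\<^sup>2"
        unfolding power_mult_distrib norm_zeta_power_square q_def .
    qed
    finally show ?thesis using 1 q by (meson mult_le_cancel_left_pos order_trans)
  qed
  moreover have "0 < K'" unfolding K'_def using K q C by simp
  ultimately show ?thesis using that[of K' \<theta>] \<theta>(1,2) by blast
qed

lemma zeta_moment_bigo_right:
  assumes a: "1 / 2 < a" "a < c" "c < 1" and M: "zeta_moment k a \<in> O[at_top](\<lambda>T. T)"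
  shows "zeta_moment k c \<in> O[at_top](\<lambda>T. T)"
proof -
  obtain K \<theta> where K: "0 < K" "0 < \<theta>" "\<theta> < 1" and bound: "\<forall>T S m. 1 \<le> T \<longrightarrow> S \<in> sets lebesgue \<longrightarrow> S \<subseteq> {0..T} \<longrightarrow> measure lebesgue S \<le> m \<longrightarrow> 0 < m \<longrightarrow>
      (LINT u:S|lebesgue. norm (zeta (Complex c u)) ^ (2 * k)) \<le> K * T powr (1 - \<theta>) * m powr \<theta>"
    by (rule zeta_power_integral_on_set_le[OF assms])
  note main = bound[rule_format]
  have "zeta_moment k c T \<le> K * T" if T: "1 \<le> T" for T
  proof -
    have "zeta_moment k c T \<le> K * T powr (1 - \<theta>) * T powr \<theta>"
      unfolding zeta_moment_def using T by (intro main) auto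
    also have "\<dots> = K * (T powr (1 - \<theta>) * T powr \<theta>)" by (simp only: mult.assoc)
    also have "T powr (1 - \<theta>) * T powr \<theta> = T" using T by (simp flip: powr_add)
    finally show ?thesis .
  qed
  then show ?thesis
    using a K by (subst zeta_moment_bigo_iff) (auto intro!: exI[of _ K])
qed

text \<open>On the line \<open>Re s = 3\<close> the mean square is at least a multiple of \<open>T\<close>. Interpolation between
\<open>\<sigma>\<close> and \<open>4\<close> then forces the quantity \<open>J\<close> on the line \<open>Re s = \<sigma>\<close> to be at least \<open>d * T\<close>. Shifts
\<open>|v| > V\<close> account for at most half of this because of the Gaussian weight, so the moment up to height \<open>T + V\<close>
must supply the rest.\<close>

lemma zeta_moment_lower:
  assumes \<sigma>: "1 / 2 < \<sigma>" "\<sigma> < 1" and M: "zeta_moment k \<sigma> \<in> O[at_top](\<lambda>T. T)"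
  shows "\<exists>c>0. \<exists>X. \<forall>T\<ge>X. c * T \<le> zeta_moment k \<sigma> T"
proof -
  have \<sigma>01: "0 < \<sigma>" "\<sigma> < 1" using \<sigma> by auto
  obtain C where C: "0 \<le> C" "\<And>T. 1 \<le> T \<Longrightarrow> zeta_moment k \<sigma> T \<le> C * T"
    using M zeta_moment_bigo_iff[OF \<sigma>01] by blast
  obtain K where K: "0 < K" and main: "\<And>S T J m. S \<in> sets lebesgue \<Longrightarrow> S \<subseteq> {0..T} \<Longrightarrow> 0 \<le> T \<Longrightarrow> 0 < J \<Longrightarrow>
      (\<And>v. exp (- 2 * v\<^sup>2) * (LINT u:{0..T}|lebesgue. (norm (zeta_power_reg k (Complex \<sigma> (u + v))))\<^sup>2) \<le> J) \<Longrightarrow>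
      measure lebesgue S \<le> m \<Longrightarrow> 0 < m \<Longrightarrow>
      (LINT u:S|lebesgue. (norm (zeta_power_reg k (Complex 3 u)))\<^sup>2)
        \<le> K * J powr ((4 - 3) / (4 - \<sigma>)) * m powr ((3 - \<sigma>) / (4 - \<sigma>))"
    using zeta_power_reg_mean_square_le[of \<sigma> 3 k] \<sigma> by auto
  define \<theta> where "\<theta> = (3 - \<sigma>) / (4 - \<sigma>)"
  have \<theta>: "0 < \<theta>" "\<theta> < 1" "(4 - 3) / (4 - \<sigma>) = 1 - \<theta>"
    unfolding \<theta>_def using \<sigma> by (auto simp: field_simps)
  define q where "q = (((1 / 4) ^ k)\<^sup>2 :: real)"
  have q: "0 < q" unfolding q_def by simp
  define d where "d = (q / K) powr (1 / (1 - \<theta>))"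
  have d: "0 < d" unfolding d_def using q K by simp
  obtain V where V: "0 \<le> V" "4 * (C + 1) * exp (- V\<^sup>2) \<le> d / 2"
  proof -
    have "((\<lambda>V::real. 4 * (C + 1) * exp (- V\<^sup>2)) \<longlongrightarrow> 0) at_top" by real_asymp
    then have "\<forall>\<^sub>F V::real in at_top. 4 * (C + 1) * exp (- V\<^sup>2) < d / 2"
      using d by (intro order_tendstoD) auto
    then have "\<forall>\<^sub>F V::real in at_top. 0 \<le> V \<and> 4 * (C + 1) * exp (- V\<^sup>2) < d / 2"
      using eventually_ge_at_top[of 0] by eventually_elim auto
    then show ?thesis using that by (auto simp: eventually_at_top_linorder less_imp_le)
  qed
  have low: "d / 4 * T \<le> zeta_moment k \<sigma> (T + V)" if T: "1 \<le> T" for T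
  proof -
    \<comment> \<open>The first summand serves the shifts \<open>|v| \<le> V\<close>, the second all others.\<close>
    define J where "J = 2 * zeta_moment k \<sigma> (T + V) + 4 * (C + 1) * exp (- V\<^sup>2) * T"
    have J: "0 < J" unfolding J_def using C T zeta_moment_nonneg[of k \<sigma> "T + V"]
      by (intro add_nonneg_pos) auto
    have qT: "q * T \<le> (LINT u:{0..T}|lebesgue. (norm (zeta_power_reg k (Complex 3 u)))\<^sup>2)"
    proof -
      have "q * T = (LINT u:{0..T}|lebesgue. q)" using T by (simp add: set_lebesgue_integral_def)
      also have "\<dots> \<le> (LINT u:{0..T}|lebesgue. (norm (zeta_power_reg k (Complex 3 u)))\<^sup>2)"
      proof (rule set_integral_mono)
        show "set_integrable lebesgue {0..T} (\<lambda>u. q)"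
          by (intro set_integrable_lebesgue_continuous[where a = 0 and b = T]) auto
        show "set_integrable lebesgue {0..T} (\<lambda>u. (norm (zeta_power_reg k (Complex 3 u)))\<^sup>2)"
          by (intro set_integrable_lebesgue_continuous[where a = 0 and b = T] continuous_intros continuous_zeta_power_reg) auto
        show "q \<le> (norm (zeta_power_reg k (Complex 3 u)))\<^sup>2" for u
          unfolding q_def by (intro power_mono zeta_power_reg_lower) auto
      qed
      finally show ?thesis .
    qed
    also have "\<dots> \<le> K * J powr ((4 - 3) / (4 - \<sigma>)) * T powr ((3 - \<sigma>) / (4 - \<sigma>))"
    proof (rule main[of _ T])
      fix v
      show "exp (- 2 * v\<^sup>2) * (LINT u:{0..T}|lebesgue. (norm (zeta_power_reg k (Complex \<sigma> (u + v))))\<^sup>2) \<le> J"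
      proof (cases "\<bar>v\<bar> \<le> V")
        case True
        define L where "L = (LINT u:{0..T}|lebesgue. (norm (zeta_power_reg k (Complex \<sigma> (u + v))))\<^sup>2)"
        have "0 \<le> L" unfolding L_def set_lebesgue_integral_def by (intro integral_nonneg_AE) auto
        then have "exp (- 2 * v\<^sup>2) * L \<le> 1 * L" by (intro mult_right_mono) auto
        also have "L \<le> 2 * zeta_moment k \<sigma> (T + \<bar>v\<bar>)"
          unfolding L_def using T by (intro shifted_zeta_moment_le \<sigma>01) auto
        also have "\<dots> \<le> 2 * zeta_moment k \<sigma> (T + V)"
          using True by (intro mult_left_mono zeta_moment_mono \<sigma>01) auto
        also have "\<dots> \<le> J" unfolding J_def using C T by simp
        finally show ?thesis unfolding L_def by simp
      next
        case False
        then have "V\<^sup>2 \<le> v\<^sup>2" using V by (intro abs_le_square_iff[THEN iffD1]) auto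
        have "exp (- 2 * v\<^sup>2) * (LINT u:{0..T}|lebesgue. (norm (zeta_power_reg k (Complex \<sigma> (u + v))))\<^sup>2) \<le> 4 * C * T * exp (- v\<^sup>2)"
          by (rule shifted_zeta_moment_gaussian_le[OF \<sigma>01 C T])
        also have "\<dots> \<le> 4 * (C + 1) * T * exp (- V\<^sup>2)"
          using \<open>V\<^sup>2 \<le> v\<^sup>2\<close> C T by (intro mult_mono) auto
        also have "\<dots> \<le> J" unfolding J_def using zeta_moment_nonneg[of k \<sigma> "T + V"] by simp
        finally show ?thesis .
      qed
    qed (use T J in auto)
    finally have "q * T \<le> K * J powr (1 - \<theta>) * T powr \<theta>" unfolding \<theta>(3) \<theta>_def[symmetric] .
    moreover have "T = T powr (1 - \<theta>) * T powr \<theta>" using T by (simp flip: powr_add)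
    ultimately have "(q * T powr (1 - \<theta>)) * T powr \<theta> \<le> (K * J powr (1 - \<theta>)) * T powr \<theta>"
      by (simp add: mult.assoc)
    then have "q * T powr (1 - \<theta>) \<le> K * J powr (1 - \<theta>)" using T by simp
    then have "q / K * T powr (1 - \<theta>) \<le> J powr (1 - \<theta>)" using K by (simp add: field_simps)
    then have "(q / K * T powr (1 - \<theta>)) powr (1 / (1 - \<theta>)) \<le> (J powr (1 - \<theta>)) powr (1 / (1 - \<theta>))"
      using q K \<theta> by (intro powr_mono2) auto
    moreover have "(q / K * T powr (1 - \<theta>)) powr (1 / (1 - \<theta>)) = d * (T powr (1 - \<theta>)) powr (1 / (1 - \<theta>))"
      unfolding d_def by (rule powr_mult)
    moreover have "(x powr (1 - \<theta>)) powr (1 / (1 - \<theta>)) = x" if "0 < x" for x :: real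
      using \<theta> that by (simp add: powr_powr)
    ultimately have "d * T \<le> J" using T J by simp
    moreover have "4 * (C + 1) * exp (- V\<^sup>2) * T \<le> d / 2 * T" using V T by (intro mult_right_mono) auto
    ultimately show ?thesis unfolding J_def by simp
  qed
  have "d / 8 * T \<le> zeta_moment k \<sigma> T" if T: "2 * V + 2 \<le> T" for T
  proof -
    have "d / 8 * T \<le> d / 4 * (T - V)" using T d V by (simp add: field_simps)
    also have "\<dots> \<le> zeta_moment k \<sigma> (T - V + V)" using T V by (intro low) auto
    finally show ?thesis by simp
  qed
  then show ?thesis using d by (intro exI[of _ "d / 8"] conjI exI[of _ "2 * V + 2"]) auto
qed

section \<open>Concentration on null sets\<close>

lemma not_bigo_identityD:
  assumes "g \<notin> O[at_top](\<lambda>T. T)" "\<And>T. 0 \<le> g T"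
  shows "\<exists>T\<ge>X. C * T < (g T :: real)"
proof (rule ccontr)
  assume neg: "\<not> (\<exists>T\<ge>X. C * T < g T)"
  have "g \<in> O[at_top](\<lambda>T. T)"
  proof (rule landau_o.bigI[of "\<bar>C\<bar> + 1"])
    show "\<forall>\<^sub>F T in at_top. norm (g T) \<le> (\<bar>C\<bar> + 1) * norm T"
      using eventually_ge_at_top[of "max X 0"]
    proof eventually_elim
      case (elim T)
      have "g T \<le> C * T" using neg elim by (auto simp: not_less)
      also have "\<dots> \<le> (\<bar>C\<bar> + 1) * T" using elim by (intro mult_right_mono) auto
      finally show ?case using assms(2)[of T] elim by simp
    qed
  qed simp
  with assms(1) show False ..
qed

lemma L2_loc_zeta_power:
  assumes "0 < \<sigma>" "\<sigma> < 1"
  shows "L2_loc (\<lambda>t. zeta (Complex \<sigma> t) ^ k)"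
  unfolding L2_loc_def
proof (intro conjI allI)
  have "(\<lambda>t. zeta (Complex \<sigma> t) ^ k) \<in> borel_measurable lborel"
    using assms by (simp add: borel_measurable_continuous_onI continuous_intros continuous_zeta_vertical)
  then have "(\<lambda>t. zeta (Complex \<sigma> t) ^ k) \<in> borel_measurable lebesgue" by (rule measurable_completion)
  then show "set_borel_measurable lebesgue {0..} (\<lambda>t. zeta (Complex \<sigma> t) ^ k)"
    unfolding set_borel_measurable_def by (intro borel_measurable_scaleR borel_measurable_indicator) auto
  show "set_integrable lebesgue {0..T} (\<lambda>t. (norm (zeta (Complex \<sigma> t) ^ k))\<^sup>2)" for T
    using assms unfolding norm_power norm_zeta_power_square by (intro set_integrable_zeta_power[where T = T]) auto
qed

lemma not_CNS_zeta_iff: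
  assumes "0 < \<sigma>" "\<sigma> < 1"
  shows "not_CNS (\<lambda>t. zeta (Complex \<sigma> t) ^ k) \<longleftrightarrow>
    (\<forall>S. null_density S \<longrightarrow> (\<lambda>T. LINT t:(S \<inter> {0..T})|lebesgue. norm (zeta (Complex \<sigma> t)) ^ (2 * k)) \<in> o[at_top](zeta_moment k \<sigma>))"
  unfolding not_CNS_def using L2_loc_zeta_power[OF assms]
  by (simp add: norm_power norm_zeta_power_square zeta_moment_def[abs_def])

lemma not_CNS_if_moment_bounded_left:
  assumes a: "1 / 2 < a" "a < \<sigma>" "\<sigma> < 1" and M: "zeta_moment k a \<in> O[at_top](\<lambda>T. T)"
  shows "not_CNS (\<lambda>t. zeta (Complex \<sigma> t) ^ k)"
proof -
  have \<sigma>01: "0 < \<sigma>" "\<sigma> < 1" using a by auto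
  obtain K \<theta> where K: "0 < K" "0 < \<theta>" "\<theta> < 1" and bound: "\<forall>T S m. 1 \<le> T \<longrightarrow> S \<in> sets lebesgue \<longrightarrow> S \<subseteq> {0..T} \<longrightarrow> measure lebesgue S \<le> m \<longrightarrow> 0 < m \<longrightarrow>
      (LINT u:S|lebesgue. norm (zeta (Complex \<sigma> u)) ^ (2 * k)) \<le> K * T powr (1 - \<theta>) * m powr \<theta>"
    by (rule zeta_power_integral_on_set_le[OF assms])
  note main = bound[rule_format]
  have "zeta_moment k \<sigma> \<in> O[at_top](\<lambda>T. T)" by (rule zeta_moment_bigo_right[OF assms])
  then obtain q X where q: "0 < q" and X: "\<And>T. X \<le> T \<Longrightarrow> q * T \<le> zeta_moment k \<sigma> T"
    using zeta_moment_lower[of \<sigma> k] a by auto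
  show ?thesis
    unfolding not_CNS_zeta_iff[OF \<sigma>01]
  proof (intro allI impI landau_o.smallI)
    fix S :: "real set" and e :: real
    assume S: "null_density S" and e: "0 < e"
    \<comment> \<open>Chosen so that \<open>K * d powr \<theta> = e * q\<close>.\<close>
    define d where "d = (e * q / K) powr (1 / \<theta>)"
    have d: "0 < d" unfolding d_def using e q K by simp
    have dth: "d powr \<theta> = e * q / K" unfolding d_def using K e q by (simp add: powr_powr)
    have "((\<lambda>T. measure lebesgue (S \<inter> {0..T}) / T) \<longlongrightarrow> 0) at_top"
      using S unfolding null_density_def by simp
    then have "\<forall>\<^sub>F T in at_top. measure lebesgue (S \<inter> {0..T}) / T < d"
      using d by (rule order_tendstoD)
    then show "\<forall>\<^sub>F T in at_top. norm (LINT t:(S \<inter> {0..T})|lebesgue. norm (zeta (Complex \<sigma> t)) ^ (2 * k)) \<le> e * norm (zeta_moment k \<sigma> T)"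
      using eventually_ge_at_top[of "max X 1"]
    proof eventually_elim
      case (elim T)
      then have T: "1 \<le> T" "X \<le> T" by auto
      define L where "L = (LINT t:(S \<inter> {0..T})|lebesgue. norm (zeta (Complex \<sigma> t)) ^ (2 * k))"
      have L0: "0 \<le> L" unfolding L_def set_lebesgue_integral_def by (intro integral_nonneg_AE) auto
      have "L \<le> K * T powr (1 - \<theta>) * (d * T) powr \<theta>"
        unfolding L_def
      proof (rule main[OF T(1)])
        show "S \<inter> {0..T} \<in> sets lebesgue" using S unfolding null_density_def by auto
        show "measure lebesgue (S \<inter> {0..T}) \<le> d * T" using elim T by (simp add: divide_less_eq)
      qed (use d T in auto)
      also have "\<dots> = K * d powr \<theta> * (T powr (1 - \<theta>) * T powr \<theta>)"
        using d T by (simp add: powr_mult)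
      also have "T powr (1 - \<theta>) * T powr \<theta> = T" using T by (simp flip: powr_add)
      also have "K * d powr \<theta> * T = e * (q * T)" unfolding dth using K by simp
      also have "\<dots> \<le> e * zeta_moment k \<sigma> T" using X[OF T(2)] e by (intro mult_left_mono) auto
      finally show ?case using L0 zeta_moment_nonneg[of k \<sigma> T] unfolding L_def[symmetric] by simp
    qed
  qed
qed

text \<open>Chebyshev's inequality for the second moment.\<close>

lemma zeta_large_values_measure:
  assumes \<sigma>: "1 / 2 < \<sigma>" "\<sigma> < 1"
  shows "\<exists>C\<ge>0. \<forall>T\<ge>1. \<forall>V>0. measure lebesgue {t \<in> {0..T}. V \<le> norm (zeta (Complex \<sigma> t))} \<le> C * T / V\<^sup>2"
proof -
  obtain C where C: "\<And>T. 1 \<le> T \<Longrightarrow> (LINT t:{0..T}|lebesgue. (norm (zeta (Complex \<sigma> t)))\<^sup>2) \<le> C * T"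
    using zeta_mean_square[OF \<sigma>] by blast
  have le: "measure lebesgue {t \<in> {0..T}. V \<le> norm (zeta (Complex \<sigma> t))} \<le> \<bar>C\<bar> * T / V\<^sup>2" if T: "1 \<le> T" and V: "0 < V" for T V
  proof -
    define A where "A = {t \<in> {0..T}. V \<le> norm (zeta (Complex \<sigma> t))}"
    have "closed {t. V \<le> norm (zeta (Complex \<sigma> t))}"
      using \<sigma> by (intro closed_Collect_le continuous_intros continuous_zeta_vertical) auto
    then have "closed ({0..T} \<inter> {t. V \<le> norm (zeta (Complex \<sigma> t))})" by (intro closed_Int) auto
    moreover have "A = {0..T} \<inter> {t. V \<le> norm (zeta (Complex \<sigma> t))}" unfolding A_def by auto
    ultimately have A: "A \<in> sets lebesgue" "A \<subseteq> {0..T}" by auto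
    have fin: "emeasure lebesgue A < \<infinity>"
      by (rule le_less_trans[OF emeasure_mono[OF A(2)]]) (use T in auto)
    have iA: "integrable lebesgue (\<lambda>t. indicat_real A t *\<^sub>R V\<^sup>2)" using A fin by simp
    have "V\<^sup>2 * measure lebesgue A = (\<integral>t. indicat_real A t *\<^sub>R V\<^sup>2 \<partial>lebesgue)"
      using A fin by simp
    also have "\<dots> \<le> (LINT t:{0..T}|lebesgue. (norm (zeta (Complex \<sigma> t)))\<^sup>2)"
      unfolding set_lebesgue_integral_def
    proof (rule integral_mono[OF iA])
      show "integrable lebesgue (\<lambda>t. indicat_real {0..T} t *\<^sub>R (norm (zeta (Complex \<sigma> t)))\<^sup>2)"
        using set_integrable_zeta_power[of \<sigma> "{0..T}" T 2] \<sigma> unfolding set_integrable_def by simp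
      show "indicat_real A t *\<^sub>R V\<^sup>2 \<le> indicat_real {0..T} t *\<^sub>R (norm (zeta (Complex \<sigma> t)))\<^sup>2" for t
        unfolding A_def using V by (auto simp: indicator_def intro: power_mono)
    qed
    also have "\<dots> \<le> C * T" by (rule C[OF T])
    also have "\<dots> \<le> \<bar>C\<bar> * T" using T by (intro mult_right_mono) auto
    finally show ?thesis unfolding A_def[symmetric] using V by (simp add: field_simps)
  qed
  then show ?thesis by (intro exI[of _ "\<bar>C\<bar>"]) auto
qed

text \<open>A fixed level would not do: the set of \<open>t\<close> with \<open>|zeta| \<ge> V\<close> need not have density zero. The
level therefore grows with \<open>t\<close>, so slowly that below the height \<open>X j\<close> it is at most \<open>j\<close>. The part
of the integral up to \<open>X j\<close> that lies below the level is then at most \<open>j ^ (2 * k) * X j\<close>, less than half of the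
moment.\<close>

lemma CNS_if_moment_unbounded:
  assumes \<sigma>: "1 / 2 < \<sigma>" "\<sigma> < 1" and M: "zeta_moment k \<sigma> \<notin> O[at_top](\<lambda>T. T)"
  shows "\<not> not_CNS (\<lambda>t. zeta (Complex \<sigma> t) ^ k)"
proof -
  have \<sigma>01: "0 < \<sigma>" "\<sigma> < 1" using \<sigma> by auto
  have "\<forall>j. \<exists>T. max 1 (real j) \<le> T \<and> 2 * real j ^ (2 * k) * T < zeta_moment k \<sigma> T"
    using not_bigo_identityD[OF M zeta_moment_nonneg] by blast
  then obtain X where "\<forall>j. max 1 (real j) \<le> X j \<and> 2 * real j ^ (2 * k) * X j < zeta_moment k \<sigma> (X j)"
    by (rule choice[THEN exE])
  then have X: "\<And>j. max 1 (real j) \<le> X j" "\<And>j. 2 * real j ^ (2 * k) * X j < zeta_moment k \<sigma> (X j)"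
    by blast+
  have X0: "0 \<le> X j" for j using X(1)[of j] by linarith
  define z where "z t = norm (zeta (Complex \<sigma> t))" for t
  have closed: "closed {t. V \<le> z t}" for V
    unfolding z_def using \<sigma> by (intro closed_Collect_le continuous_intros continuous_zeta_vertical) auto
  define S where "S = (\<Union>j. {0..X j} \<inter> {t. real j \<le> z t})"
  have Sm: "S \<in> sets lebesgue"
    unfolding S_def using closed by (intro sets.countable_UN) auto
  obtain C where C: "0 \<le> C" "\<And>T V. 1 \<le> T \<Longrightarrow> 0 < V \<Longrightarrow> measure lebesgue {t \<in> {0..T}. V \<le> z t} \<le> C * T / V\<^sup>2"
    using zeta_large_values_measure[OF \<sigma>] unfolding z_def by blast
  have null: "null_density S"
    unfolding null_density_def
  proof (intro conjI)
    show "S \<in> sets lebesgue" by (rule Sm)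
    show "S \<subseteq> {0..}" unfolding S_def by auto
    show "((\<lambda>T. measure lebesgue (S \<inter> {0..T}) / T) \<longlongrightarrow> 0) at_top"
    proof (rule tendstoI)
      fix e :: real assume e: "0 < e"
      obtain J :: nat where J: "2 * C / e + 1 < real J" using reals_Archimedean2 by blast
      have J1: "1 \<le> real J" using J C e by (smt (verit) divide_nonneg_pos mult_nonneg_nonneg)
      have CJ: "C / (real J)\<^sup>2 < e / 2"
      proof -
        have "2 * C / e < real J * 1" using J by simp
        also have "\<dots> \<le> real J * real J" using J1 by (intro mult_left_mono) auto
        finally show ?thesis using e J1 by (simp add: field_simps power2_eq_square)
      qed
      \<comment> \<open>Beyond \<open>Y\<close> only indices \<open>j \<ge> J\<close> contribute to \<open>S\<close>.\<close>
      define Y where "Y = (\<Sum>i<J. X i)"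
      have Y: "0 \<le> Y" unfolding Y_def using X0 by (intro sum_nonneg) auto
      have XY: "X i \<le> Y" if "i < J" for i
        unfolding Y_def using that X0 by (intro member_le_sum) auto
      have bound: "measure lebesgue (S \<inter> {0..T}) \<le> Y + C * T / (real J)\<^sup>2" if T: "1 \<le> T" for T
      proof -
        define A where "A = {t \<in> {0..T}. real J \<le> z t}"
        have "A = {0..T} \<inter> {t. real J \<le> z t}" unfolding A_def by auto
        then have A: "A \<in> sets lebesgue" using closed[of "real J"] by auto
        have finA: "A \<in> lmeasurable"
          by (rule bounded_set_imp_lmeasurable[OF bounded_subset[OF bounded_closed_interval[of 0 T]] A]) (auto simp: A_def)
        have sub: "S \<inter> {0..T} \<subseteq> {0..Y} \<union> A"
        proof
          fix t assume t: "t \<in> S \<inter> {0..T}"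
          then obtain j where j: "0 \<le> t" "t \<le> X j" "real j \<le> z t" unfolding S_def by auto
          show "t \<in> {0..Y} \<union> A"
          proof (cases "j < J")
            case True
            then show ?thesis using XY[OF True] j by auto
          next
            case False
            then show ?thesis using j t unfolding A_def by auto
          qed
        qed
        have "measure lebesgue (S \<inter> {0..T}) \<le> measure lebesgue ({0..Y} \<union> A)"
          using Sm finA by (intro measure_mono_fmeasurable[OF sub]) (auto intro: fmeasurable.Un)
        also have "\<dots> \<le> measure lebesgue {0..Y} + measure lebesgue A"
          using A by (intro measure_Un_le) auto
        also have "\<dots> \<le> Y + C * T / (real J)\<^sup>2"
          using C(2)[OF T, of "real J"] J1 Y unfolding A_def by simp
        finally show ?thesis .
      qed
      show "\<forall>\<^sub>F T in at_top. dist (measure lebesgue (S \<inter> {0..T}) / T) 0 < e"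
        using eventually_gt_at_top[of "max 1 (2 * Y / e)"]
      proof eventually_elim
        case (elim T)
        have T: "1 \<le> T" "2 * Y / e < T" using elim by auto
        have "measure lebesgue (S \<inter> {0..T}) \<le> Y + T * (C / (real J)\<^sup>2)"
          using bound[OF T(1)] by (simp add: mult.commute)
        also have "\<dots> < T * (e / 2) + T * (e / 2)"
          using T CJ e by (intro add_strict_mono mult_strict_left_mono) (auto simp: field_simps)
        finally show ?case using T by (simp add: field_simps)
      qed
    qed
  qed
  show ?thesis
  proof
    assume "not_CNS (\<lambda>t. zeta (Complex \<sigma> t) ^ k)"
    then have "(\<lambda>T. LINT t:(S \<inter> {0..T})|lebesgue. z t ^ (2 * k)) \<in> o[at_top](zeta_moment k \<sigma>)"
      using null unfolding not_CNS_zeta_iff[OF \<sigma>01] z_def by blast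
    then have "\<forall>\<^sub>F T in at_top. norm (LINT t:(S \<inter> {0..T})|lebesgue. z t ^ (2 * k)) \<le> 1 / 4 * norm (zeta_moment k \<sigma> T)"
      by (rule landau_o.smallD) simp
    then obtain T0 where T0: "\<And>T. T0 \<le> T \<Longrightarrow> norm (LINT t:(S \<inter> {0..T})|lebesgue. z t ^ (2 * k)) \<le> 1 / 4 * norm (zeta_moment k \<sigma> T)"
      by (auto simp: eventually_at_top_linorder)
    obtain j :: nat where j: "T0 < real j" using reals_Archimedean2 by blast
    define T where "T = X j"
    have T: "T0 \<le> T" "1 \<le> T" using X(1)[of j] j unfolding T_def by auto
    define m where "m = zeta_moment k \<sigma> T"
    have m: "2 * real j ^ (2 * k) * T < m" unfolding m_def T_def by (rule X(2))
    have int: "set_integrable lebesgue R (\<lambda>t. z t ^ (2 * k))" if "R \<in> sets lebesgue" "R \<subseteq> {0..T}" for R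
      unfolding z_def using set_integrable_zeta_power[OF \<sigma>01 that] .
    have D: "{0..T} - S \<in> sets lebesgue" using Sm by (intro sets.Diff) auto
    have "m = (LINT t:((S \<inter> {0..T}) \<union> ({0..T} - S))|lebesgue. z t ^ (2 * k))"
      unfolding m_def zeta_moment_def z_def by (rule arg_cong2[where f = "set_lebesgue_integral lebesgue"]) auto
    also have "\<dots> = (LINT t:(S \<inter> {0..T})|lebesgue. z t ^ (2 * k)) + (LINT t:({0..T} - S)|lebesgue. z t ^ (2 * k))"
      using Sm by (intro set_integral_Un int) auto
    also have "(LINT t:({0..T} - S)|lebesgue. z t ^ (2 * k)) \<le> (LINT t:{0..T}|lebesgue. real j ^ (2 * k))"
      unfolding set_lebesgue_integral_def
    proof (rule integral_mono)
      show "integrable lebesgue (\<lambda>t. indicat_real ({0..T} - S) t *\<^sub>R z t ^ (2 * k))"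
        using int[OF D] unfolding set_integrable_def by auto
      show "integrable lebesgue (\<lambda>t. indicat_real {0..T} t *\<^sub>R real j ^ (2 * k))"
        using set_integrable_lebesgue_continuous[where a = 0 and b = T and S = "{0..T}" and g = "\<lambda>t. real j ^ (2 * k)"]
        unfolding set_integrable_def by simp
      fix t
      have "z t < real j" if "t \<in> {0..T} - S"
        using that unfolding S_def T_def by (auto simp: not_le dest: spec[of _ j])
      then show "indicat_real ({0..T} - S) t *\<^sub>R z t ^ (2 * k) \<le> indicat_real {0..T} t *\<^sub>R real j ^ (2 * k)"
        by (cases "t \<in> {0..T} - S") (auto intro!: power_mono simp: z_def)
    qed
    also have "(LINT t:{0..T}|lebesgue. real j ^ (2 * k)) = real j ^ (2 * k) * T"
      using T by (simp add: set_lebesgue_integral_def)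
    also have "\<dots> < m / 2" using m by simp
    finally have "m / 2 < (LINT t:(S \<inter> {0..T})|lebesgue. z t ^ (2 * k))" by simp
    also have "\<dots> \<le> 1 / 4 * norm m" using T0[OF T(1)] unfolding m_def by simp
    finally have "m < 0" using zeta_moment_nonneg[of k \<sigma> T] unfolding m_def by simp
    then show False using zeta_moment_nonneg[of k \<sigma> T] unfolding m_def by simp
  qed
qed

theorem theorem1:
  fixes k :: nat and \<sigma> :: real
  assumes "k \<ge> 1"
    and "zeta_mu (1 / 2) < ereal (1 / (2 * real k))"
    and "1 / 2 < \<sigma>" and "\<sigma> < 1"
    and "ereal \<sigma> \<noteq> sigma_crit k"
  shows "not_CNS (\<lambda>t. zeta (Complex \<sigma> t) ^ k) \<longleftrightarrow> sigma_crit k < ereal \<sigma> \<and> \<sigma> < 1"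
proof
  assume "sigma_crit k < ereal \<sigma> \<and> \<sigma> < 1"
  then obtain s where s: "1 / 2 \<le> s" "s < \<sigma>"
    and M: "\<And>\<tau>. s < \<tau> \<Longrightarrow> \<tau> < 1 \<Longrightarrow> zeta_moment k \<tau> \<in> O[at_top](\<lambda>T. T)"
    unfolding sigma_crit_def by (auto simp: INF_less_iff)
  show "not_CNS (\<lambda>t. zeta (Complex \<sigma> t) ^ k)"
    using s assms(4) by (intro not_CNS_if_moment_bounded_left[of "(s + \<sigma>) / 2"] M) auto
next
  assume nc: "not_CNS (\<lambda>t. zeta (Complex \<sigma> t) ^ k)"
  have M: "zeta_moment k \<sigma> \<in> O[at_top](\<lambda>T. T)"
    using CNS_if_moment_unbounded[OF assms(3,4)] nc by blast
  have "sigma_crit k \<le> ereal \<sigma>"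
    unfolding sigma_crit_def
    using assms(3,4) zeta_moment_bigo_right[OF assms(3) _ _ M] by (intro INF_lower) auto
  then show "sigma_crit k < ereal \<sigma> \<and> \<sigma> < 1"
    using assms(4,5) by auto
qed

end
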